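(* Let $(Q(t))_{t\ge0}$ be a regular HA-semigroup on $D$ and let $(\gamma(t))_{t\ge0}$ be a stochastically continuous SC-semigroup associated with $(Q(t))_{t\ge0}$. Then $$P(t,x,\cdot)=Q(t,x,\cdot)*\gamma(t,\cdot),\qquad t\ge0,\ x\in D,$$ defines a Feller affine semigroup $(P(t))_{t\ge0}$ on $D$.
   Context: $D=\mathbb{R}_+\times\mathbb{R}$ with $\mathbb{R}_+=[0,\infty)$; $U=\mathbb{C}_-\times(i\mathbb{R})$, where $\mathbb{C}_-=\{a+ib: a\le 0,\ b\in\mathbb{R}\}$ and $i\mathbb{R}=\{ib:b\in\mathbb{R}\}$; $\langle u,\xi\rangle=u_1\xi_1+u_2\xi_2$ (bilinear); $*$ denotes convolution. HA-semigroup: a transition semigroup $(Q(t))_{t\ge0}$ with state space $D$ such that for each $t\ge0$ there is a continuous two-dimensional complex-valued function $\psi(t,\cdot)=(\psi_1(t,\cdot),\psi_2(t,\cdot))$ on $U$ with $\int_D \exp\{\langle u,\xi\rangle\}Q(t,x,d\xi)=\exp\{\langle x,\psi(t,u)\rangle\}$ for all $x\in D$, $u\in U$. It is stochastically continuous if $t\mapsto Q(t,x,\cdot)$ is weakly continuous on $[0,\infty)$ for each $x\in D$. It is regular if it is stochastically continuous and the derivative $\psi'_t(0,u)$ exists for all $u\in U$ and is continuous at $u=0$. SC-semigroup associated with $(Q(t))_{t\ge0}$: a family of probability measures $(\gamma(t))_{t\ge0}$ on $D$ with $\gamma(r+t)=(\gamma(r)Q(t))*\gamma(t)$ for all $r,t\ge0$,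 where $\gamma(r)Q(t)(B)=\int_D Q(t,\xi,B)\gamma(r,d\xi)$. It is stochastically continuous if $t\mapsto\gamma(t)$ is weakly continuous on $[0,\infty)$. A transition semigroup $(P(t))_{t\ge0}$ on $D$ is an affine semigroup associated with $(Q(t))_{t\ge0}$ if $\int_D\exp\{\langle u,\xi\rangle\}P(t,x,d\xi)=\exp\{\langle x,\psi(t,u)\rangle+\phi(t,u)\}$ for all $t\ge 0$, $x\in D$, $u\in U$, where $\phi(t,\cdot)$ is a continuous function on $U$ with $\phi(t,0)=0$. Feller means that each $P(t)$ maps $C_0(D)$ (continuous functions vanishing at infinity) into itself and $P(t)f\to f$ as $t\to0$ for $f\in C_0(D)$. *)

theory Defs
  imports "HOL-Probability.Probability"
begin

definition stateD :: "(real \<times> real) set" where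
  "stateD = {x. 0 \<le> fst x}"

definition domU :: "(complex \<times> complex) set" where
  "domU = {u. Re (fst u) \<le> 0 \<and> Re (snd u) = 0}"

abbreviation borelD :: "(real \<times> real) measure" where
  "borelD \<equiv> restrict_space borel stateD"

(* The symmetric bilinear pairing; in every use one argument is complex and the other real,
   so both \<langle>u, \<xi>\<rangle> and \<langle>x, \<psi>\<rangle> are written with the complex argument first. *)
definition pairing :: "complex \<times> complex \<Rightarrow> real \<times> real \<Rightarrow> complex" where
  "pairing u x = fst u * complex_of_real (fst x) + snd u * complex_of_real (snd x)"

(* The library convolution is a Borel measure on the whole plane; stateD is closed under
   addition, so for measures on stateD nothing is lost by restricting back to stateD. *)
definition convD ::
    "(real \<times> real) measure \<Rightarrow> (real \<times> real) measure \<Rightarrow> (real \<times> real) measure" where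
  "convD \<mu> \<nu> = restrict_space (\<mu> \<star> \<nu>) stateD"

(* Families indexed by t \<ge> 0 are functions on all of real, and kernels are functions on the
   whole plane; the values at t < 0 and at x outside stateD are irrelevant throughout.
   For a kernel K, the measure \<mu> \<bind> K is B \<mapsto> \<integral> K(\<xi>, B) \<mu>(d\<xi>), so the last conjunct is the
   Chapman-Kolmogorov equation. *)
definition transition_semigroup :: "(real \<Rightarrow> real \<times> real \<Rightarrow> (real \<times> real) measure) \<Rightarrow> bool" where
  "transition_semigroup Q \<longleftrightarrow>
     (\<forall>t\<ge>0. Q t \<in> borelD \<rightarrow>\<^sub>M prob_algebra borelD) \<and>
     (\<forall>x\<in>stateD. Q 0 x = return borelD x) \<and>
     (\<forall>r\<ge>0. \<forall>t\<ge>0. \<forall>x\<in>stateD. Q (r + t) x = Q r x \<bind> Q t)"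

definition weakly_continuous :: "(real \<Rightarrow> (real \<times> real) measure) \<Rightarrow> bool" where
  "weakly_continuous \<mu> \<longleftrightarrow>
     (\<forall>f :: real \<times> real \<Rightarrow> real. continuous_on stateD f \<longrightarrow> bounded (f ` stateD) \<longrightarrow>
        continuous_on {0..} (\<lambda>t. \<integral>\<xi>. f \<xi> \<partial>(\<mu> t)))"

(* The exponent \<psi> is an explicit parameter, shared with the regularity condition and with the
   associated affine semigroups. *)
definition HA_semigroup ::
    "(real \<Rightarrow> real \<times> real \<Rightarrow> (real \<times> real) measure) \<Rightarrow>
     (real \<Rightarrow> complex \<times> complex \<Rightarrow> complex \<times> complex) \<Rightarrow> bool" where
  "HA_semigroup Q \<psi> \<longleftrightarrow>
     transition_semigroup Q \<and>
     (\<forall>t\<ge>0. continuous_on domU (\<psi> t) \<and>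
        (\<forall>x\<in>stateD. \<forall>u\<in>domU. (\<integral>\<xi>. exp (pairing u \<xi>) \<partial>(Q t x)) = exp (pairing (\<psi> t u) x)))"

(* The derivative at t = 0 is one-sided, and continuity at u = 0 is relative to domU. *)
definition regular_HA_semigroup ::
    "(real \<Rightarrow> real \<times> real \<Rightarrow> (real \<times> real) measure) \<Rightarrow>
     (real \<Rightarrow> complex \<times> complex \<Rightarrow> complex \<times> complex) \<Rightarrow> bool" where
  "regular_HA_semigroup Q \<psi> \<longleftrightarrow>
     HA_semigroup Q \<psi> \<and>
     (\<forall>x\<in>stateD. weakly_continuous (\<lambda>t. Q t x)) \<and>
     (\<exists>\<psi>' :: complex \<times> complex \<Rightarrow> complex \<times> complex.
        (\<forall>u\<in>domU. ((\<lambda>t. \<psi> t u) has_vector_derivative \<psi>' u) (at 0 within {0..})) \<and>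
        continuous (at 0 within domU) \<psi>')"

definition SC_semigroup ::
    "(real \<Rightarrow> real \<times> real \<Rightarrow> (real \<times> real) measure) \<Rightarrow> (real \<Rightarrow> (real \<times> real) measure) \<Rightarrow> bool" where
  "SC_semigroup Q \<gamma> \<longleftrightarrow>
     (\<forall>t\<ge>0. \<gamma> t \<in> space (prob_algebra borelD)) \<and>
     (\<forall>r\<ge>0. \<forall>t\<ge>0. \<gamma> (r + t) = convD (\<gamma> r \<bind> Q t) (\<gamma> t))"

(* P is an affine semigroup associated with the HA-semigroup Q, which has exponent \<psi>. *)
definition affine_semigroup ::
    "(real \<Rightarrow> real \<times> real \<Rightarrow> (real \<times> real) measure) \<Rightarrow>
     (real \<Rightarrow> complex \<times> complex \<Rightarrow> complex \<times> complex) \<Rightarrow>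
     (real \<Rightarrow> real \<times> real \<Rightarrow> (real \<times> real) measure) \<Rightarrow> bool" where
  "affine_semigroup Q \<psi> P \<longleftrightarrow>
     HA_semigroup Q \<psi> \<and> transition_semigroup P \<and>
     (\<exists>\<phi> :: real \<Rightarrow> complex \<times> complex \<Rightarrow> complex. \<forall>t\<ge>0.
        continuous_on domU (\<phi> t) \<and> \<phi> t 0 = 0 \<and>
        (\<forall>x\<in>stateD. \<forall>u\<in>domU.
           (\<integral>\<xi>. exp (pairing u \<xi>) \<partial>(P t x)) = exp (pairing (\<psi> t u) x + \<phi> t u)))"

(* stateD is closed in the plane, so vanishing at infinity (outside compact subsets of stateD)
   is convergence to 0 as the norm tends to infinity within stateD. *)
definition C0D :: "(real \<times> real \<Rightarrow> real) set" where
  "C0D = {f. continuous_on stateD f \<and> (f \<longlongrightarrow> 0) (inf at_infinity (principal stateD))}"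

(* Convergence in C0D is in the supremum norm over stateD. *)
definition feller :: "(real \<Rightarrow> real \<times> real \<Rightarrow> (real \<times> real) measure) \<Rightarrow> bool" where
  "feller P \<longleftrightarrow>
     (\<forall>f\<in>C0D.
        (\<forall>t\<ge>0. (\<lambda>x. \<integral>\<xi>. f \<xi> \<partial>(P t x)) \<in> C0D) \<and>
        uniform_limit stateD (\<lambda>t x. \<integral>\<xi>. f \<xi> \<partial>(P t x)) f (at_right 0))"

end

(*
  The transforms of the measures satisfy P(t,x)^(u) = exp <x, psi(t,u)> g(t,u) with g(t,u) the
  transform of gamma(t), so Chapman-Kolmogorov reduces to the flow property of psi, to
  g(r+t,u) = g(r,psi(t,u)) g(t,u), and to uniqueness of transforms.  The function g has no zeros:
  at the first zero t0 of g(.,u) one would get g(r, psi(t0-r,u)) = 0 for all small r, although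
  gamma(r) tends to the point mass at 0.  Since U is convex, g has a continuous logarithm phi.

  For the Feller property, the span of the functions exp(-l x1 - c x2^2 + y x2) is dense in C0(D) by
  Stone-Weierstrass, and writing the Gaussian factor as the Fourier transform of a normal law
  shows that asymptotically equal transforms force asymptotically equal integrals of C0-functions.
  If t_n -> t and x_n -> infinity, then P(t_n,x_n) escapes to infinity along a subsequence: either
  the first coordinate of x_n diverges, where Re psi_1(t,u) < 0 for Re u1 < 0 applies, or the second
  one does, where psi_2(t,u) = b(t) u2 with b(t) nonzero exhibits P(t_n,x_n) as an asymptotic
  translate.  The facts on psi_1 and psi_2 follow by halving t: a degeneracy at t would persist at
  t / 2^n, hence at 0, where psi(0,u) = u.
*)

theory Submission
  imports Defs
begin

section \<open>Test functions on the half plane\<close>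

text \<open>When the second coordinate of \<open>x_n\<close> diverges, transforms cannot be expected
  to converge: \<open>u2\<close> is imaginary, so exp(psi_2 x2) keeps modulus one and merely
  oscillates. The limit theorems therefore compare two sequences of measures, neither of which has
  to converge. Decay to zero is comparison with the zero measure, which is why they are stated for
  sub-probability measures. The damping exp(-l x1) with l > 0 means that only transforms with Re u1
  < 0 are tested, exactly where divergence of the first coordinate makes them small. Linearity of
  psi_2 in u comes from symmetry: D contains (0, 1) and (0, -1), which forces Re psi_2 = 0, so Q(t,
  (0, s)) has a transform of modulus one on all of U. Its characters are then almost surely
  constant, and their multiplicativity passes to the transform. An exponential determines its
  exponent only modulo 2 pi i. The ambiguity disappears because x may be scaled by every s \<ge> 0,
  which yields both the flow property of psi and its continuity in time.\<close>

lemma stateD_add: "x \<in> stateD \<Longrightarrow> y \<in> stateD \<Longrightarrow> x + y \<in> stateD"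
  by (auto simp: stateD_def)

lemma closed_stateD: "closed stateD"
  unfolding stateD_def by (intro closed_Collect_le continuous_intros)

lemma sets_borel_stateD [measurable, simp]: "stateD \<in> sets borel"
  using closed_stateD by (rule borel_closed)

lemma C0D_iff:
  "f \<in> C0D \<longleftrightarrow> continuous_on stateD f \<and>
     (\<forall>e>0. \<exists>R. \<forall>x\<in>stateD. R \<le> norm x \<longrightarrow> \<bar>f x\<bar> < e)"
  unfolding C0D_def tendsto_iff
  by (simp add: eventually_inf_principal eventually_at_infinity dist_real_def Ball_def
      del: split_paired_All) (meson)

section \<open>Gaussian-exponential test functions and their linear span\<close>

text \<open>\<open>l\<close> damps the first coordinate and \<open>c\<close> the second. The linear
  term \<open>y\<close> makes the family see the sign of the second coordinate and keeps it closed
  under products.\<close>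

definition gauss_exp :: "real \<Rightarrow> real \<Rightarrow> real \<Rightarrow> real \<times> real \<Rightarrow> real" where
  "gauss_exp l c y \<xi> = exp (- l * fst \<xi> - c * (snd \<xi>)\<^sup>2 + y * snd \<xi>)"

text \<open>The coefficient sits in the generators, so closure under scalar multiples is a
  consequence. Products of generators are generators because exponents add, so the span is an
  algebra.\<close>

inductive_set gauss_span :: "(real \<times> real \<Rightarrow> real) set" where
  gen: "0 < l \<Longrightarrow> 0 < c \<Longrightarrow> (\<lambda>\<xi>. a * gauss_exp l c y \<xi>) \<in> gauss_span"
| add: "f \<in> gauss_span \<Longrightarrow> g \<in> gauss_span \<Longrightarrow> (\<lambda>\<xi>. f \<xi> + g \<xi>) \<in> gauss_span"

lemma gauss_exp_mult:
  "gauss_exp l c y \<xi> * gauss_exp l' c' y' \<xi> = gauss_exp (l + l') (c + c') (y + y') \<xi>"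
  by (simp add: gauss_exp_def exp_add[symmetric] algebra_simps)

lemma gauss_span_mult:
  assumes "f \<in> gauss_span" "g \<in> gauss_span"
  shows "(\<lambda>\<xi>. f \<xi> * g \<xi>) \<in> gauss_span"
  using assms(1)
proof induction
  case (gen l c a y)
  note lc = gen
  show ?case using assms(2)
  proof induction
    case (gen l' c' a' y')
    have "(\<lambda>\<xi>. a * gauss_exp l c y \<xi> * (a' * gauss_exp l' c' y' \<xi>))
        = (\<lambda>\<xi>. (a * a') * gauss_exp (l + l') (c + c') (y + y') \<xi>)"
      by (simp add: gauss_exp_mult[symmetric] mult_ac fun_eq_iff)
    then show ?case
      using gauss_span.gen[of "l + l'" "c + c'" "a * a'" "y + y'"] gen lc by simp
  qed (auto simp: distrib_left dest: gauss_span.add)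
qed (auto simp: distrib_right dest: gauss_span.add)

lemma gauss_exp_le:
  assumes c: "0 < c"
  shows "gauss_exp l c y \<xi> \<le> exp ((\<bar>y\<bar> + 1)\<^sup>2 / (4 * c) - l * fst \<xi> - \<bar>snd \<xi>\<bar>)"
proof -
  let ?v = "\<bar>snd \<xi>\<bar>"
  \<comment> \<open>Completing the square with \<open>\<bar>y\<bar> + 1\<close> in place of
    \<open>\<bar>y\<bar>\<close> leaves one spare multiple of \<open>?v\<close>, the linear decay in
    the bound.\<close>
  have "0 \<le> c * (?v - (\<bar>y\<bar> + 1) / (2 * c))\<^sup>2" using c by simp
  also have "\<dots> = c * ?v\<^sup>2 - (\<bar>y\<bar> + 1) * ?v + (\<bar>y\<bar> + 1)\<^sup>2 / (4 * c)"
    using c by (simp add: field_simps power2_eq_square)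
  finally have "- c * (snd \<xi>)\<^sup>2 + (\<bar>y\<bar> + 1) * ?v \<le> (\<bar>y\<bar> + 1)\<^sup>2 / (4 * c)"
    by simp
  moreover have "y * snd \<xi> \<le> \<bar>y\<bar> * ?v" by (metis abs_ge_self abs_mult)
  ultimately show ?thesis by (simp add: gauss_exp_def algebra_simps)
qed

lemma gauss_exp_C0D:
  assumes "0 < l" "0 < c"
  shows "gauss_exp l c y \<in> C0D"
proof -
  have "\<exists>R. \<forall>x\<in>stateD. R \<le> norm x \<longrightarrow> \<bar>gauss_exp l c y x\<bar> < e" if "0 < e" for e
  proof -
    let ?C = "(\<bar>y\<bar> + 1)\<^sup>2 / (4 * c)"
    have m: "0 < min l 1" using assms by simp
    show ?thesis
    proof (intro exI ballI impI)
      \<comment> \<open>The exponent falls at rate at least \<open>min l 1\<close> in the norm; the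
        summand 1 in the radius makes the final inequality strict.\<close>
      fix x assume x: "x \<in> stateD" and R: "(?C - ln e + 1) / min l 1 \<le> norm x"
      have "norm x \<le> fst x + \<bar>snd x\<bar>"
        using norm_Pair_le[of "fst x" "snd x"] x by (simp add: stateD_def)
      then have "min l 1 * norm x \<le> min l 1 * fst x + min l 1 * \<bar>snd x\<bar>"
        using m by (metis distrib_left mult_le_cancel_left_pos)
      also have "\<dots> \<le> l * fst x + 1 * \<bar>snd x\<bar>"
        using x by (intro add_mono mult_right_mono) (auto simp: stateD_def)
      finally have "?C - ln e + 1 \<le> l * fst x + \<bar>snd x\<bar>"
        using R m by (simp add: pos_divide_le_eq mult.commute)
      then have "exp (?C - l * fst x - \<bar>snd x\<bar>) < exp (ln e)" by simp
      also have "\<dots> = e" using that by simp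
      finally have "gauss_exp l c y x < e"
        using gauss_exp_le[OF assms(2), of l y x] by linarith
      then show "\<bar>gauss_exp l c y x\<bar> < e"
        by (simp add: gauss_exp_def)
    qed
  qed
  then show ?thesis
    unfolding C0D_iff gauss_exp_def by (auto intro!: continuous_intros)
qed

lemma C0D_add: "f \<in> C0D \<Longrightarrow> g \<in> C0D \<Longrightarrow> (\<lambda>\<xi>. f \<xi> + g \<xi>) \<in> C0D"
  unfolding C0D_def by (auto intro!: continuous_intros tendsto_add_zero)

lemma C0D_cmult: "f \<in> C0D \<Longrightarrow> (\<lambda>\<xi>. a * f \<xi>) \<in> C0D"
  unfolding C0D_def by (auto intro!: continuous_intros tendsto_mult_right_zero)

lemma gauss_span_C0D: "f \<in> gauss_span \<Longrightarrow> f \<in> C0D"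
  by (induction rule: gauss_span.induct) (auto intro: C0D_add C0D_cmult gauss_exp_C0D)

lemma C0D_bounded:
  assumes "f \<in> C0D"
  obtains B where "0 < B" "\<And>x. x \<in> stateD \<Longrightarrow> \<bar>f x\<bar> \<le> B"
proof -
  from assms obtain R where R: "\<And>x. x \<in> stateD \<Longrightarrow> R \<le> norm x \<Longrightarrow> \<bar>f x\<bar> < 1"
    unfolding C0D_iff by (meson zero_less_one)
  have "compact (stateD \<inter> cball 0 R)"
    using closed_stateD by (simp add: closed_Int_compact)
  then have "bounded (f ` (stateD \<inter> cball 0 R))"
    using assms by (auto simp: C0D_def intro!: compact_imp_bounded compact_continuous_image
      intro: continuous_on_subset)
  then obtain B where B: "\<And>x. x \<in> stateD \<Longrightarrow> norm x \<le> R \<Longrightarrow> \<bar>f x\<bar> \<le> B"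
    unfolding bounded_iff by fastforce
  show ?thesis
  proof (rule that[of "max 1 B"])
    fix x assume "x \<in> stateD"
    then show "\<bar>f x\<bar> \<le> max 1 B" using B[of x] R[of x] by linarith
  qed simp
qed

text \<open>The half sphere is the one-point compactification of \<^const>\<open>stateD\<close>:
  \<open>\<xi>\<close> corresponds to \<open>(w, w \<xi>\<^sub>1, w \<xi>\<^sub>2)\<close> with \<open>w = 1 / (1 + |\<xi>|\<^sup>2)\<close>, and infinity to the origin.\<close>

definition half_sphere :: "(real \<times> real \<times> real) set" where
  "half_sphere = {(a, b, c). a\<^sup>2 + b\<^sup>2 + c\<^sup>2 = a \<and> 0 \<le> b}"

definition compactified :: "(real \<times> real \<Rightarrow> real) \<Rightarrow> real \<times> real \<times> real \<Rightarrow> real" where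
  "compactified f = (\<lambda>(a, b, c). if a = 0 then 0 else f (b / a, c / a))"

section \<open>Geometry of the half sphere\<close>

lemma half_sphere_0: "(a, b, c) \<in> half_sphere \<Longrightarrow> a = 0 \<Longrightarrow> b = 0 \<and> c = 0"
  by (simp add: half_sphere_def sum_power2_eq_zero_iff)

lemma half_sphere_nonneg: "(a, b, c) \<in> half_sphere \<Longrightarrow> 0 \<le> a"
  unfolding half_sphere_def by simp (smt (verit) zero_le_power2)

text \<open>Dividing the sphere equation by \<open>a\<close> identifies \<open>a\<close> as the
  weight 1 / (1 + |\<xi>|^2) of \<xi> = \<open>(b / a, c / a)\<close>. Small \<open>a\<close> thus
  means large norm, and \<xi> determines the point.\<close>

lemma half_sphere_norm:
  assumes "(a, b, c) \<in> half_sphere" "a \<noteq> 0"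
  shows "a * (1 + (norm (b / a, c / a))\<^sup>2) = 1" "(b / a, c / a) \<in> stateD"
proof -
  have eq: "a\<^sup>2 + b\<^sup>2 + c\<^sup>2 = a" using assms by (simp add: half_sphere_def)
  have "a * (1 + (norm (b / a, c / a))\<^sup>2) = a * (1 + (b / a)\<^sup>2 + (c / a)\<^sup>2)"
    by (simp add: norm_Pair power_divide)
  also have "\<dots> = (a\<^sup>2 + b\<^sup>2 + c\<^sup>2) / a"
    using assms(2) by (simp add: field_simps power2_eq_square)
  finally show "a * (1 + (norm (b / a, c / a))\<^sup>2) = 1" using eq assms(2) by simp
  show "(b / a, c / a) \<in> stateD"
    using assms half_sphere_nonneg[OF assms(1)] by (simp add: stateD_def half_sphere_def)
qed

lemma compact_half_sphere: "compact half_sphere"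
proof -
  have "closed half_sphere" "bounded half_sphere"
  proof -
  show "closed half_sphere"
    unfolding half_sphere_def split_def
    by (intro closed_Collect_conj closed_Collect_eq closed_Collect_le continuous_intros)
  show "bounded half_sphere"
  proof (rule boundedI)
    fix x assume "x \<in> half_sphere"
    then obtain a b c where x: "x = (a, b, c)" and eq: "a\<^sup>2 + b\<^sup>2 + c\<^sup>2 = a"
      by (auto simp: half_sphere_def)
    have "a\<^sup>2 \<le> a" using eq by (smt (verit) zero_le_power2)
    then have "a \<le> 1" by (smt (verit, best) mult_cancel_left1 mult_strict_left_mono power2_eq_square)
    then show "norm x \<le> 1" using eq by (simp add: x norm_Pair)
  qed
  qed
  then show ?thesis by (simp add: compact_eq_bounded_closed)
qed

text \<open>One point \<open>s\<close> serves all \<open>f\<close> at once, so uniform estimates on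
  the half sphere carry over to \<open>stateD\<close>.\<close>

lemma half_sphere_embed:
  assumes "\<xi> \<in> stateD"
  obtains s where "s \<in> half_sphere" "\<And>f. compactified f s = f \<xi>"
proof -
  define w where "w = 1 / (1 + (norm \<xi>)\<^sup>2)"
  have w: "0 < w" "w * (1 + (fst \<xi>)\<^sup>2 + (snd \<xi>)\<^sup>2) = 1"
    by (auto simp: w_def norm_prod_def add_nonneg_pos add_pos_nonneg field_simps)
       (smt (verit) zero_le_power2)+
  show ?thesis
  proof (rule that[of "(w, w * fst \<xi>, w * snd \<xi>)"])
    have "w\<^sup>2 + (w * fst \<xi>)\<^sup>2 + (w * snd \<xi>)\<^sup>2 = w * (w * (1 + (fst \<xi>)\<^sup>2 + (snd \<xi>)\<^sup>2))"
      by (simp add: algebra_simps power2_eq_square)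
    then show "(w, w * fst \<xi>, w * snd \<xi>) \<in> half_sphere"
      using assms w by (simp add: half_sphere_def stateD_def)
  qed (use w in \<open>simp add: compactified_def\<close>)
qed

section \<open>Stone-Weierstrass on the compactification\<close>

text \<open>Away from the origin the function is a composition with division by the nonzero first
  coordinate; at the origin continuity is the vanishing of \<open>f\<close> at infinity.\<close>

lemma continuous_on_compactified:
  assumes "f \<in> C0D"
  shows "continuous_on half_sphere (compactified f)"
proof -
  have cont: "continuous_on stateD f" using assms by (simp add: C0D_def)
  have "continuous (at s within half_sphere) (compactified f)" if s: "s \<in> half_sphere" for s
  proof (cases "fst s = 0")
    case False
    let ?V = "half_sphere \<inter> {s. fst s \<noteq> 0}"
    have op: "openin (top_of_set half_sphere) ?V"
      by (rule openin_open_Int) (intro open_Collect_neq continuous_intros)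
    have "continuous_on ?V (\<lambda>s. f (fst (snd s) / fst s, snd (snd s) / fst s))"
      by (intro continuous_on_compose2[OF cont] continuous_intros)
         (auto dest: half_sphere_norm)
    then have "continuous_on ?V (compactified f)"
      by (rule continuous_on_eq) (auto simp: compactified_def split_def)
    then have "continuous (at s within ?V) (compactified f)"
      using s False by (simp add: continuous_on_eq_continuous_within)
    then show ?thesis
      using at_within_nhd[of s "{s. fst s \<noteq> 0}" half_sphere ?V] False
      by (auto simp: open_Collect_neq continuous_on_fst)
  next
    case True
    then have s0: "s = 0"
      using s True half_sphere_0 by (metis prod.collapse zero_prod_def)
    have "\<exists>d>0. \<forall>z\<in>half_sphere. dist z 0 < d \<longrightarrow> dist (compactified f z) (compactified f 0) < e"
      if e: "0 < e" for e
    proof -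
      from assms e obtain R where R: "\<And>x. x \<in> stateD \<Longrightarrow> R \<le> norm x \<Longrightarrow> \<bar>f x\<bar> < e"
        unfolding C0D_iff by meson
      have R1: "0 < 1 + R\<^sup>2" by (smt (verit) zero_le_power2)
      show ?thesis
      proof (intro exI conjI ballI impI)
        \<comment> \<open>This radius is the weight of a point of norm \<open>R\<close>: a point of
          the sphere closer to the origin has a smaller first coordinate, hence comes from a point
          of norm at least \<open>R\<close>.\<close>
        show "0 < 1 / (1 + R\<^sup>2)" using R1 by simp
        fix z :: "real \<times> real \<times> real" assume z: "z \<in> half_sphere" "dist z 0 < 1 / (1 + R\<^sup>2)"
        obtain a b c where abc: "z = (a, b, c)" by (cases z)
        show "dist (compactified f z) (compactified f 0) < e"
        proof (cases "a = 0")
          case True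
          then show ?thesis using e by (simp add: compactified_def abc zero_prod_def)
        next
          case False
          note hs = half_sphere_norm[OF z(1)[unfolded abc] False]
          have a: "0 < a" using half_sphere_nonneg[OF z(1)[unfolded abc]] False by simp
          have "a \<le> norm z" unfolding abc by (metis a abs_of_pos norm_fst_le real_norm_def)
          then have "a * (1 + R\<^sup>2) < 1" using z(2) R1 by (simp add: pos_less_divide_eq) (smt (verit) R1 mult_right_mono)
          then have "1 + R\<^sup>2 < 1 + (norm (b / a, c / a))\<^sup>2"
            using hs(1) a by (smt (verit) mult_left_mono)
          then have "R \<le> norm (b / a, c / a)"
            by (metis add_less_cancel_left less_eq_real_def norm_ge_zero power2_less_imp_less)
          then show ?thesis using R[OF hs(2)] False
            by (simp add: compactified_def abc zero_prod_def)
        qed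
      qed
    qed
    then show ?thesis unfolding s0 continuous_within_eps_delta by blast
  qed
  then show ?thesis by (simp add: continuous_on_eq_continuous_within)
qed

text \<open>Positivity of the test functions separates finite points from infinity. At finite points
  the exponents must agree: varying \<open>l\<close> recovers the first coordinate, varying
  \<open>y\<close> the second, and the weight \<open>a\<close> is then determined by
  \<open>half_sphere_norm\<close>.\<close>

lemma compactified_gauss_separates:
  assumes "s \<in> half_sphere" "s' \<in> half_sphere" "s \<noteq> s'"
  shows "\<exists>f\<in>gauss_span. compactified f s \<noteq> compactified f s'"
proof (rule ccontr)
  assume "\<not> ?thesis"
  then have eq: "compactified f s = compactified f s'" if "f \<in> gauss_span" for f
    using that by blast
  have g: "gauss_exp l c y \<in> gauss_span" if "0 < l" "0 < c" for l c y
    using gauss_span.gen[OF that, of 1 y] by simp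
  obtain a b c where s: "s = (a, b, c)" by (cases s)
  obtain a' b' c' where s': "s' = (a', b', c')" by (cases s')
  have pos: "gauss_exp l d y x > 0" for l d y x by (simp add: gauss_exp_def)
  show False
  proof (cases "a = 0 \<or> a' = 0")
    case True
    then have "a = 0 \<and> a' = 0"
      using eq[OF g[of 1 1 0]] pos[of 1 1 0 "(b/a, c/a)"] pos[of 1 1 0 "(b'/a', c'/a')"]
      by (auto simp: compactified_def s s' split: if_splits)
    then show False using half_sphere_0 assms s s' by blast
  next
    case False
    have eq': "- l * (b/a) - d * (c/a)\<^sup>2 + y * (c/a) = - l * (b'/a') - d * (c'/a')\<^sup>2 + y * (c'/a')"
      if "0 < l" "0 < d" for l d y
      using eq[OF g[OF that, of y]] False by (simp add: compactified_def s s' gauss_exp_def)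
    have 1: "b / a = b' / a'" using eq'[of 1 1 0] eq'[of 2 1 0] by simp
    have 2: "c / a = c' / a'" using eq'[of 1 1 0] eq'[of 1 1 1] by simp
    have "a * (1 + (norm (b' / a', c' / a'))\<^sup>2) = 1" "a' * (1 + (norm (b' / a', c' / a'))\<^sup>2) = 1"
      using half_sphere_norm(1)[of a b c] half_sphere_norm(1)[of a' b' c'] assms False
      by (auto simp: s s' 1 2)
    then have "a = a'" by (metis mult_cancel_right mult_zero_right zero_neq_one)
    with 1 2 False assms(3) show False by (simp add: s s')
  qed
qed

text \<open>Stone-Weierstrass needs an algebra with constants, so constants are adjoined on the half
  sphere and afterwards discarded at a cost of \<open>e / 2\<close>.\<close>

lemma gauss_span_dense:
  assumes f: "f \<in> C0D" and e: "0 < e"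
  obtains g where "g \<in> gauss_span" "\<And>x. x \<in> stateD \<Longrightarrow> \<bar>f x - g x\<bar> < e"
proof -
  define R where "R = {h. \<exists>g\<in>gauss_span. \<exists>k. h = (\<lambda>s. compactified g s + k)}"
  have RI: "(\<lambda>s. compactified g s + k) \<in> R" if "g \<in> gauss_span" for g k
    using that by (auto simp: R_def)
  interpret function_ring_on R half_sphere
  proof
    show "compact half_sphere" by (rule compact_half_sphere)
  next
    fix h assume "h \<in> R"
    then show "continuous_on half_sphere h"
      by (auto simp: R_def intro!: continuous_intros continuous_on_compactified gauss_span_C0D)
  next
    fix h h' assume "h \<in> R" "h' \<in> R"
    then obtain g k g' k' where *: "g \<in> gauss_span" "g' \<in> gauss_span"
      "h = (\<lambda>s. compactified g s + k)" "h' = (\<lambda>s. compactified g' s + k')"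
      by (auto simp: R_def)
    have "(\<lambda>s. h s + h' s) = (\<lambda>s. compactified (\<lambda>\<xi>. g \<xi> + g' \<xi>) s + (k + k'))"
      by (auto simp: * compactified_def fun_eq_iff)
    then show "(\<lambda>s. h s + h' s) \<in> R" using * by (auto intro!: RI gauss_span.add)
    have cm: "(\<lambda>\<xi>. r * f \<xi>) \<in> gauss_span" if "f \<in> gauss_span" for r f
      using that
    proof induction
      case (gen l c a y)
      then show ?case using gauss_span.gen[of l c "r * a" y] by (simp add: mult.assoc)
    qed (auto simp: distrib_left dest: gauss_span.add)
    have "(\<lambda>s. h s * h' s)
        = (\<lambda>s. compactified (\<lambda>\<xi>. g \<xi> * g' \<xi> + (k' * g \<xi> + k * g' \<xi>)) s + k * k')"
      by (auto simp: * compactified_def fun_eq_iff algebra_simps)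
    then show "(\<lambda>s. h s * h' s) \<in> R"
      using * by (auto intro!: RI gauss_span.add gauss_span_mult cm)
  next
    fix k
    have "(\<lambda>\<xi>. 0 * gauss_exp 1 1 0 \<xi>) \<in> gauss_span" by (intro gauss_span.gen) auto
    then have "(\<lambda>s. compactified (\<lambda>\<xi>. 0 * gauss_exp 1 1 0 \<xi>) s + k) \<in> R" by (rule RI)
    also have "(\<lambda>s. compactified (\<lambda>\<xi>. 0 * gauss_exp 1 1 0 \<xi>) s + k) = (\<lambda>s. k)"
      by (auto simp: compactified_def fun_eq_iff)
    finally show "(\<lambda>s. k) \<in> R" .
  next
    fix s s' assume "s \<in> half_sphere" "s' \<in> half_sphere" "s \<noteq> s'"
    from compactified_gauss_separates[OF this] obtain g where
      "g \<in> gauss_span" "compactified g s \<noteq> compactified g s'" by blast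
    then show "\<exists>f\<in>R. f s \<noteq> f s'" using RI[of g 0] by (intro bexI[of _ "compactified g"]) simp_all
  qed
  obtain g k where g: "g \<in> gauss_span"
    and gk: "\<And>s. s \<in> half_sphere \<Longrightarrow> \<bar>compactified f s - (compactified g s + k)\<bar> < e / 2"
    using Stone_Weierstrass_basic[OF continuous_on_compactified[OF f], of "e / 2"] e
    unfolding R_def by auto
  \<comment> \<open>At the point at infinity both compactified functions vanish, so the
    approximation there bounds the constant \<open>k\<close> itself.\<close>
  have "(0, 0, 0) \<in> half_sphere" by (simp add: half_sphere_def)
  from gk[OF this] have k: "\<bar>k\<bar> < e / 2" by (simp add: compactified_def)
  show ?thesis
  proof (rule that[OF g])
    fix x assume "x \<in> stateD"
    then obtain s where s: "s \<in> half_sphere" "\<And>f. compactified f s = f x"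
      using half_sphere_embed by blast
    from gk[OF s(1)] k show "\<bar>f x - g x\<bar> < e" unfolding s(2) by linarith
  qed
qed

section \<open>Transforms of measures on the half plane\<close>

abbreviation probD :: "(real \<times> real) measure set" where
  "probD \<equiv> space (prob_algebra borelD)"

abbreviation subprobD :: "(real \<times> real) measure set" where
  "subprobD \<equiv> space (subprob_algebra borelD)"

lemma probDD:
  assumes "\<mu> \<in> probD"
  shows "prob_space \<mu>" "sets \<mu> = sets borelD" "space \<mu> = stateD"
  using assms sets_eq_imp_space_eq[of \<mu> borelD]
  by (auto simp: space_prob_algebra space_restrict_space)

lemma probD_subprobD: "\<mu> \<in> probD \<Longrightarrow> \<mu> \<in> subprobD"
  by (auto simp: space_prob_algebra space_subprob_algebra prob_space_imp_subprob_space)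

lemma subprobDD:
  assumes "\<mu> \<in> subprobD"
  shows "subprob_space \<mu>" "sets \<mu> = sets borelD" "space \<mu> = stateD"
  using assms sets_eq_imp_space_eq[of \<mu> borelD]
  by (auto simp: space_subprob_algebra space_restrict_space)

lemma measurableD_continuous:
  fixes f :: "real \<times> real \<Rightarrow> 'b::topological_space"
  assumes "continuous_on stateD f" "\<mu> \<in> subprobD"
  shows "f \<in> borel_measurable \<mu>"
  using borel_measurable_continuous_on_restrict[OF assms(1)] subprobDD(2)[OF assms(2)]
  by (simp cong: measurable_cong_sets)

lemma integrableD:
  fixes f :: "real \<times> real \<Rightarrow> 'b::{banach, second_countable_topology}"
  assumes f: "continuous_on stateD f" "\<And>x. x \<in> stateD \<Longrightarrow> norm (f x) \<le> B" and \<mu>: "\<mu> \<in> subprobD"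
  shows "integrable \<mu> f"
proof -
  interpret subprob_space \<mu> by (rule subprobDD[OF \<mu>])
  show ?thesis
    by (rule integrable_const_bound[where B = B])
       (use f subprobDD(3)[OF \<mu>] in \<open>auto intro!: AE_I2 measurableD_continuous[OF f(1) \<mu>]\<close>)
qed

lemma integrableD_C0D:
  assumes f: "f \<in> C0D" and \<mu>: "\<mu> \<in> subprobD"
  shows "integrable \<mu> f"
proof -
  obtain B where "\<And>x. x \<in> stateD \<Longrightarrow> \<bar>f x\<bar> \<le> B" using C0D_bounded[OF f] by metis
  then show ?thesis using f \<mu> by (intro integrableD[where B = B]) (simp_all add: C0D_def)
qed

lemma integralD_abs_diff_le:
  fixes f g :: "real \<times> real \<Rightarrow> real"
  assumes \<mu>: "\<mu> \<in> subprobD" and f: "integrable \<mu> f" and g: "integrable \<mu> g"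
    and le: "\<And>x. x \<in> stateD \<Longrightarrow> \<bar>f x - g x\<bar> \<le> e" and e: "0 \<le> e"
  shows "\<bar>(\<integral>x. f x \<partial>\<mu>) - (\<integral>x. g x \<partial>\<mu>)\<bar> \<le> e"
proof -
  interpret subprob_space \<mu> by (rule subprobDD[OF \<mu>])
  have "\<bar>(\<integral>x. f x \<partial>\<mu>) - (\<integral>x. g x \<partial>\<mu>)\<bar> = \<bar>\<integral>x. f x - g x \<partial>\<mu>\<bar>"
    using f g by simp
  also have "\<dots> \<le> (\<integral>x. \<bar>f x - g x\<bar> \<partial>\<mu>)"
    by (rule integral_abs_bound)
  also have "\<dots> \<le> (\<integral>x. e \<partial>\<mu>)"
    by (intro integral_mono) (use f g le subprobDD(3)[OF \<mu>] in auto)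
  also have "\<dots> \<le> e"
    using e mult_right_mono[OF subprob_measure_le_1 e] by simp
  finally show ?thesis .
qed

section \<open>The transform and its elementary bounds\<close>

text \<open>On \<open>domU\<close> this is a Laplace transform in the first coordinate and a Fourier
  transform in the second; the integrand has modulus at most one there.\<close>

definition transform :: "(real \<times> real) measure \<Rightarrow> complex \<times> complex \<Rightarrow> complex" where
  "transform \<mu> u = (\<integral>\<xi>. exp (pairing u \<xi>) \<partial>\<mu>)"

lemma continuous_on_pairing [continuous_intros]:
  "continuous_on A f \<Longrightarrow> continuous_on A g \<Longrightarrow> continuous_on A (\<lambda>x. pairing (f x) (g x))"
  unfolding pairing_def by (intro continuous_intros)

lemma tendsto_pairing [tendsto_intros]:
  "(f \<longlongrightarrow> u) F \<Longrightarrow> (g \<longlongrightarrow> x) F \<Longrightarrow> ((\<lambda>z. pairing (f z) (g z)) \<longlongrightarrow> pairing u x) F"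
  unfolding pairing_def by (intro tendsto_intros)

lemma pairing_add_left: "pairing (u + v) x = pairing u x + pairing v x"
  and pairing_add_right: "pairing u (x + y) = pairing u x + pairing u y"
  and pairing_zero [simp]: "pairing 0 x = 0" "pairing u 0 = 0"
  by (simp_all add: pairing_def algebra_simps)

lemma Re_pairing: "u \<in> domU \<Longrightarrow> Re (pairing u x) = Re (fst u) * fst x"
  by (simp add: pairing_def domU_def)

lemma norm_exp_pairing_le:
  assumes "u \<in> domU" "x \<in> stateD"
  shows "norm (exp (pairing u x)) \<le> 1"
  using assms Re_pairing[OF assms(1), of x]
  by (simp add: stateD_def domU_def mult_nonpos_nonneg)

lemma integrable_exp_pairing:
  "u \<in> domU \<Longrightarrow> \<mu> \<in> subprobD \<Longrightarrow> integrable \<mu> (\<lambda>\<xi>. exp (pairing u \<xi>))"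
  by (rule integrableD[where B = 1]) (intro continuous_intros, rule norm_exp_pairing_le)

lemma transform_0: "\<mu> \<in> probD \<Longrightarrow> transform \<mu> 0 = 1"
  using prob_space.prob_space[OF probDD(1)] by (simp add: transform_def)

lemma norm_transform_le:
  assumes u: "u \<in> domU" and \<mu>: "\<mu> \<in> subprobD"
  shows "norm (transform \<mu> u) \<le> 1"
proof -
  interpret subprob_space \<mu> by (rule subprobDD[OF \<mu>])
  have "norm (transform \<mu> u) \<le> (\<integral>\<xi>. norm (exp (pairing u \<xi>)) \<partial>\<mu>)"
    unfolding transform_def by (rule integral_norm_bound)
  also have "\<dots> \<le> (\<integral>\<xi>. 1 \<partial>\<mu>)"
    by (intro integral_mono integrable_norm integrable_exp_pairing u \<mu> norm_exp_pairing_le)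
       (use subprobDD(3)[OF \<mu>] in auto)
  also have "\<dots> \<le> 1" using subprob_measure_le_1 by simp
  finally show ?thesis .
qed

lemma continuous_on_transform:
  assumes \<mu>: "\<mu> \<in> subprobD"
  shows "continuous_on domU (transform \<mu>)"
proof -
  interpret subprob_space \<mu> by (rule subprobDD[OF \<mu>])
  show ?thesis
    unfolding continuous_on_sequentially comp_def transform_def
  proof safe
    fix v :: "nat \<Rightarrow> complex \<times> complex" and u
    assume u: "u \<in> domU" "\<forall>n. v n \<in> domU" "v \<longlonglongrightarrow> u"
    have e: "(\<lambda>\<xi>. exp (pairing w \<xi>)) \<in> borel_measurable \<mu>" for w
      by (intro measurableD_continuous[OF _ \<mu>] continuous_intros)
    show "(\<lambda>n. \<integral>\<xi>. exp (pairing (v n) \<xi>) \<partial>\<mu>) \<longlonglongrightarrow> (\<integral>\<xi>. exp (pairing u \<xi>) \<partial>\<mu>)"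
    proof (rule integral_dominated_convergence[where w = "\<lambda>_. 1"])
      show "AE \<xi> in \<mu>. norm (exp (pairing (v n) \<xi>)) \<le> 1" for n
        using norm_exp_pairing_le u subprobDD(3)[OF \<mu>] by (intro AE_I2) blast
      show "AE \<xi> in \<mu>. (\<lambda>n. exp (pairing (v n) \<xi>)) \<longlonglongrightarrow> exp (pairing u \<xi>)"
        by (intro AE_I2 tendsto_intros u)
    qed (use e in simp_all)
  qed
qed

section \<open>From transforms to integrals of C0-functions\<close>

lemma integral_std_normal_exp: "(\<integral>z. exp (\<i> * of_real (z * t)) \<partial>std_normal_distribution) = of_real (exp (- t\<^sup>2 / 2))"
  using fun_cong[OF char_std_normal_distribution, of t] by (simp add: char_def mult.commute)

lemma prob_space_std_normal: "prob_space std_normal_distribution"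
  by (rule prob_space_normal_density) simp

lemma fst_borelD [measurable]: "fst \<in> borelD \<rightarrow>\<^sub>M borel"
  and snd_borelD [measurable]: "snd \<in> borelD \<rightarrow>\<^sub>M borel"
  by (intro measurable_restrict_space1 borel_measurable_continuous_onI continuous_intros)+

text \<open>Writing the Gaussian factor as the Fourier transform of a normal variable reduces the test
  functions to values of the transform.\<close>

lemma integral_gauss_exp:
  fixes l c y :: real
  assumes \<mu>: "\<mu> \<in> subprobD" and l: "0 \<le> l" and c: "0 < c"
  defines "s \<equiv> sqrt (2 * c)" and "m \<equiv> y / (2 * c)"
  shows "of_real (\<integral>\<xi>. gauss_exp l c y \<xi> \<partial>\<mu>) = of_real (exp (y\<^sup>2 / (4 * c))) *
    (\<integral>z. exp (- \<i> * of_real (z * s * m)) * transform \<mu> (- of_real l, \<i> * of_real (z * s)) \<partial>std_normal_distribution)"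
proof -
  let ?N = "std_normal_distribution"
  interpret N: prob_space ?N by (rule prob_space_std_normal)
  interpret M: subprob_space \<mu> by (rule subprobDD[OF \<mu>])
  note [measurable_cong] = subprobDD(2)[OF \<mu>]
  interpret P: pair_sigma_finite \<mu> ?N ..
  interpret P': finite_measure "\<mu> \<Otimes>\<^sub>M ?N"
    by (intro finite_measure_pair_measure) unfold_locales
  let ?f = "\<lambda>\<xi> z. exp (- \<i> * of_real (z * s * m)) * exp (pairing (- of_real l, \<i> * of_real (z * s)) \<xi>)"
  have dom: "(- of_real l, \<i> * of_real (z * s)) \<in> domU" for z
    using l by (simp add: domU_def)
  have int: "integrable (\<mu> \<Otimes>\<^sub>M ?N) (case_prod ?f)"
  proof (rule P'.integrable_const_bound[where B = 1])
    show "AE x in \<mu> \<Otimes>\<^sub>M ?N. norm (case_prod ?f x) \<le> 1"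
      using norm_exp_pairing_le[OF dom] subprobDD(3)[OF \<mu>]
      by (intro AE_I2) (auto simp: norm_mult space_pair_measure simp del: of_real_mult)
    show "case_prod ?f \<in> borel_measurable (\<mu> \<Otimes>\<^sub>M ?N)"
      unfolding pairing_def by measurable
  qed
  have inner: "(\<integral>z. ?f \<xi> z \<partial>?N) = of_real (exp (- (y\<^sup>2 / (4 * c))) * gauss_exp l c y \<xi>)" for \<xi>
  proof -
    have eq: "?f \<xi> z = of_real (exp (- l * fst \<xi>)) * exp (\<i> * of_real (z * (s * (snd \<xi> - m))))" for z
    proof -
      have "?f \<xi> z = exp (of_real (- l * fst \<xi>) + \<i> * of_real (z * (s * (snd \<xi> - m))))"
        unfolding pairing_def exp_add[symmetric] by (simp add: algebra_simps)
      then show ?thesis by (simp only: exp_add exp_of_real)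
    qed
    \<comment> \<open>\<open>s\<close> is scaled so that half the square has leading coefficient
      \<open>c\<close>, and \<open>m\<close> is the centre of the completed square. The leftover
      constant is the source of the prefactor exp(y^2 / (4 c)).\<close>
    have sq: "(s * (snd \<xi> - m))\<^sup>2 / 2 = c * (snd \<xi>)\<^sup>2 - y * snd \<xi> + y\<^sup>2 / (4 * c)"
    proof -
      have "(s * (snd \<xi> - m))\<^sup>2 / 2 = c * (snd \<xi> - m)\<^sup>2"
        using c by (simp add: s_def power_mult_distrib)
      also have "\<dots> = c * (snd \<xi>)\<^sup>2 - (2 * c * m) * snd \<xi> + c * m\<^sup>2"
        by (simp add: power2_eq_square algebra_simps)
      also have "2 * c * m = y" using c by (simp add: m_def)
      also have "c * m\<^sup>2 = y\<^sup>2 / (4 * c)" using c by (simp add: m_def power2_eq_square)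
      finally show ?thesis .
    qed
    have "(\<integral>z. ?f \<xi> z \<partial>?N) = of_real (exp (- l * fst \<xi>)) * of_real (exp (- (s * (snd \<xi> - m))\<^sup>2 / 2))"
      unfolding eq by (simp only: integral_mult_right_zero integral_std_normal_exp)
    also have "\<dots> = of_real (exp (- l * fst \<xi> + - (s * (snd \<xi> - m))\<^sup>2 / 2))"
      by (simp only: exp_add of_real_mult)
    also have "- l * fst \<xi> + - (s * (snd \<xi> - m))\<^sup>2 / 2
        = - (y\<^sup>2 / (4 * c)) + (- l * fst \<xi> - c * (snd \<xi>)\<^sup>2 + y * snd \<xi>)"
      using sq by (simp only: minus_divide_left[symmetric])
    also have "exp \<dots> = exp (- (y\<^sup>2 / (4 * c))) * gauss_exp l c y \<xi>"
      by (simp only: exp_add gauss_exp_def)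
    finally show ?thesis .
  qed
  have "(\<integral>z. exp (- \<i> * of_real (z * s * m)) * transform \<mu> (- of_real l, \<i> * of_real (z * s)) \<partial>?N)
      = (\<integral>z. (\<integral>\<xi>. ?f \<xi> z \<partial>\<mu>) \<partial>?N)"
    unfolding transform_def by simp
  also have "\<dots> = (\<integral>\<xi>. (\<integral>z. ?f \<xi> z \<partial>?N) \<partial>\<mu>)"
    by (rule P.Fubini_integral[OF int])
  also have "\<dots> = of_real (exp (- (y\<^sup>2 / (4 * c)))) * of_real (\<integral>\<xi>. gauss_exp l c y \<xi> \<partial>\<mu>)"
    unfolding inner by (simp only: integral_complex_of_real of_real_mult integral_mult_right_zero)
  finally show ?thesis
    by (simp add: exp_minus)
qed

text \<open>All masses are at most one, so replacing \<open>f\<close> by a uniformly close element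
  of the span costs at most \<open>e / 3\<close> for each of the two measures, uniformly in
  \<open>n\<close>.\<close>

lemma tendsto_integral_diff_gauss:
  assumes \<mu>: "\<And>n. \<mu> n \<in> subprobD" and \<nu>: "\<And>n. \<nu> n \<in> subprobD"
    and lim: "\<And>l c y. 0 < l \<Longrightarrow> 0 < c \<Longrightarrow>
      (\<lambda>n. (\<integral>\<xi>. gauss_exp l c y \<xi> \<partial>\<mu> n) - (\<integral>\<xi>. gauss_exp l c y \<xi> \<partial>\<nu> n)) \<longlonglongrightarrow> 0"
    and f: "f \<in> C0D"
  shows "(\<lambda>n. (\<integral>\<xi>. f \<xi> \<partial>\<mu> n) - (\<integral>\<xi>. f \<xi> \<partial>\<nu> n)) \<longlonglongrightarrow> 0"
proof -
  have span: "(\<lambda>n. (\<integral>\<xi>. g \<xi> \<partial>\<mu> n) - (\<integral>\<xi>. g \<xi> \<partial>\<nu> n)) \<longlonglongrightarrow> 0" if "g \<in> gauss_span" for g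
    using that
  proof induction
    case (gen l c a y)
    then show ?case
      using tendsto_mult_right_zero[OF lim[of l c y], of a] by (simp add: right_diff_distrib)
  next
    case (add g h)
    have "integrable (\<mu> n) g" "integrable (\<mu> n) h" "integrable (\<nu> n) g" "integrable (\<nu> n) h" for n
      using add \<mu> \<nu> by (auto intro: integrableD_C0D gauss_span_C0D)
    then show ?case using tendsto_add_zero[OF add.IH] by (simp add: algebra_simps)
  qed
  show ?thesis
  proof (rule LIMSEQ_I)
    fix e :: real assume e: "0 < e"
    obtain g where g: "g \<in> gauss_span" "\<And>x. x \<in> stateD \<Longrightarrow> \<bar>f x - g x\<bar> < e / 3"
      using gauss_span_dense[OF f, of "e / 3"] e by auto
    have diff: "\<bar>(\<integral>x. f x \<partial>\<kappa>) - (\<integral>x. g x \<partial>\<kappa>)\<bar> \<le> e / 3" if "\<kappa> \<in> subprobD" for \<kappa>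
      using integralD_abs_diff_le[OF that integrableD_C0D[OF f that]
        integrableD_C0D[OF gauss_span_C0D[OF g(1)] that] less_imp_le[OF g(2)]] e by simp
    obtain N where N: "\<And>n. N \<le> n \<Longrightarrow> \<bar>(\<integral>\<xi>. g \<xi> \<partial>\<mu> n) - (\<integral>\<xi>. g \<xi> \<partial>\<nu> n)\<bar> < e / 3"
      using LIMSEQ_D[OF span[OF g(1)], of "e / 3"] e by auto
    have "norm ((\<integral>\<xi>. f \<xi> \<partial>\<mu> n) - (\<integral>\<xi>. f \<xi> \<partial>\<nu> n) - 0) < e" if "N \<le> n" for n
      using N[OF that] diff[OF \<mu>[of n]] diff[OF \<nu>[of n]] unfolding real_norm_def by linarith
    then show "\<exists>N. \<forall>n\<ge>N. norm ((\<integral>\<xi>. f \<xi> \<partial>\<mu> n) - (\<integral>\<xi>. f \<xi> \<partial>\<nu> n) - 0) < e" by blast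
  qed
qed

lemma borel_measurable_transform_line [measurable]:
  assumes "\<mu> \<in> subprobD" "0 \<le> l"
  shows "(\<lambda>z. transform \<mu> (- of_real l, \<i> * of_real (z * s))) \<in> borel_measurable borel"
  by (intro borel_measurable_continuous_onI continuous_on_compose2[OF continuous_on_transform[OF assms(1)]]
      continuous_intros) (use assms in \<open>auto simp: domU_def\<close>)

text \<open>A continuity theorem for vague convergence: mass may escape to infinity, so it also covers
  sequences whose transforms tend to zero.\<close>

lemma tendsto_integral_diff_transform:
  assumes \<mu>: "\<And>n. \<mu> n \<in> subprobD" and \<nu>: "\<And>n. \<nu> n \<in> subprobD"
    and lim: "\<And>u. u \<in> domU \<Longrightarrow> Re (fst u) < 0 \<Longrightarrow>
      (\<lambda>n. transform (\<mu> n) u - transform (\<nu> n) u) \<longlonglongrightarrow> 0"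
    and f: "f \<in> C0D"
  shows "(\<lambda>n. (\<integral>\<xi>. f \<xi> \<partial>\<mu> n) - (\<integral>\<xi>. f \<xi> \<partial>\<nu> n)) \<longlonglongrightarrow> 0"
proof (rule tendsto_integral_diff_gauss[OF \<mu> \<nu> _ f])
  fix l c y :: real assume lc: "0 < l" "0 < c"
  let ?N = "std_normal_distribution"
  interpret N: prob_space ?N by (rule prob_space_std_normal)
  define s m where "s = sqrt (2 * c)" and "m = y / (2 * c)"
  define F where "F \<kappa> z = exp (- \<i> * of_real (z * s * m)) * transform \<kappa> (- of_real l, \<i> * of_real (z * s))"
    for \<kappa> z
  have dom: "(- of_real l, \<i> * of_real (z * s)) \<in> domU" for z
    using lc by (simp add: domU_def)
  have meas: "F \<kappa> \<in> borel_measurable ?N" if \<kappa>: "\<kappa> \<in> subprobD" for \<kappa>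
  proof -
    note [measurable] = borel_measurable_transform_line[OF \<kappa> less_imp_le[OF lc(1)]]
    show ?thesis unfolding F_def by measurable
  qed
  have bd: "norm (F \<kappa> z) \<le> 1" if "\<kappa> \<in> subprobD" for \<kappa> z
    using norm_transform_le[OF dom that] by (simp add: F_def norm_mult del: of_real_mult)
  have int: "integrable ?N (F \<kappa>)" if "\<kappa> \<in> subprobD" for \<kappa>
    using bd meas that by (intro N.integrable_const_bound[where B = 1] AE_I2)
  have "(\<lambda>n. \<integral>z. F (\<mu> n) z - F (\<nu> n) z \<partial>?N) \<longlonglongrightarrow> (\<integral>z. 0 \<partial>?N)"
  proof (rule integral_dominated_convergence[where w = "\<lambda>_. 2"])
    show "AE z in ?N. (\<lambda>n. F (\<mu> n) z - F (\<nu> n) z) \<longlonglongrightarrow> 0"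
    proof (rule AE_I2)
      fix z
      have "(\<lambda>n. transform (\<mu> n) (- of_real l, \<i> * of_real (z * s))
          - transform (\<nu> n) (- of_real l, \<i> * of_real (z * s))) \<longlonglongrightarrow> 0"
        using lc by (intro lim dom) simp
      from tendsto_mult_right_zero[OF this, of "exp (- \<i> * of_real (z * s * m))"]
      show "(\<lambda>n. F (\<mu> n) z - F (\<nu> n) z) \<longlonglongrightarrow> 0"
        unfolding F_def by (simp only: right_diff_distrib)
    qed
    show "AE z in ?N. norm (F (\<mu> n) z - F (\<nu> n) z) \<le> 2" for n
    proof (rule AE_I2)
      fix z
      show "norm (F (\<mu> n) z - F (\<nu> n) z) \<le> 2"
        using norm_triangle_ineq4[of "F (\<mu> n) z" "F (\<nu> n) z"] bd[OF \<mu>[of n], of z] bd[OF \<nu>[of n], of z]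
        by linarith
    qed
  qed (use meas \<mu> \<nu> in simp_all)
  then have "(\<lambda>n. of_real (exp (y\<^sup>2 / (4 * c))) * ((\<integral>z. F (\<mu> n) z \<partial>?N) - (\<integral>z. F (\<nu> n) z \<partial>?N))) \<longlonglongrightarrow> 0"
    using int \<mu> \<nu> by (intro tendsto_mult_right_zero) simp
  then have "(\<lambda>n. of_real ((\<integral>\<xi>. gauss_exp l c y \<xi> \<partial>\<mu> n) - (\<integral>\<xi>. gauss_exp l c y \<xi> \<partial>\<nu> n)) :: complex) \<longlonglongrightarrow> of_real 0"
    unfolding of_real_diff integral_gauss_exp[OF \<mu> less_imp_le[OF lc(1)] lc(2)]
      integral_gauss_exp[OF \<nu> less_imp_le[OF lc(1)] lc(2)] s_def[symmetric] m_def[symmetric] F_def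
    by (simp only: right_diff_distrib of_real_0)
  then show "(\<lambda>n. (\<integral>\<xi>. gauss_exp l c y \<xi> \<partial>\<mu> n) - (\<integral>\<xi>. gauss_exp l c y \<xi> \<partial>\<nu> n)) \<longlonglongrightarrow> 0"
    unfolding tendsto_of_real_iff .
qed

text \<open>Indicators of closed sets are bounded pointwise limits of C0-functions, and closed sets
  form an intersection-stable generator of the Borel sets.\<close>

lemma probD_eqI_C0D:
  assumes \<mu>: "\<mu> \<in> probD" and \<nu>: "\<nu> \<in> probD"
    and eq: "\<And>f. f \<in> C0D \<Longrightarrow> (\<integral>\<xi>. f \<xi> \<partial>\<mu>) = (\<integral>\<xi>. f \<xi> \<partial>\<nu>)"
  shows "\<mu> = \<nu>"
proof -
  have closed_eq: "emeasure \<mu> (C \<inter> stateD) = emeasure \<nu> (C \<inter> stateD)" if C: "closed C" for C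
  proof (cases "C = {}")
    case False
    \<comment> \<open>The second factor tends to the indicator of \<open>C\<close> as the slope
      grows. The first factor forces decay at infinity and tends to one.\<close>
    define f where "f n \<xi> = exp (- (norm \<xi> / Suc n)) * max 0 (1 - Suc n * infdist \<xi> C)"
      for n and \<xi> :: "real \<times> real"
    have f01: "\<bar>f n \<xi>\<bar> \<le> exp (- (norm \<xi> / Suc n))" for n \<xi>
      unfolding f_def abs_mult
      by (rule order_trans[OF mult_left_mono[of _ 1]]) (auto simp: infdist_nonneg)
    have cont: "continuous_on stateD (f n)" for n
      unfolding f_def by (intro continuous_intros) simp
    have C0: "f n \<in> C0D" for n
      unfolding C0D_iff
    proof (intro conjI allI impI cont)
      fix e :: real assume e: "0 < e"
      show "\<exists>R. \<forall>x\<in>stateD. R \<le> norm x \<longrightarrow> \<bar>f n x\<bar> < e"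
      proof (intro exI ballI impI)
        fix x :: "real \<times> real" assume "Suc n * (1 - ln e) \<le> norm x"
        then have "1 - ln e \<le> norm x / Suc n" by (simp add: field_simps)
        then have "exp (- (norm x / Suc n)) < exp (ln e)" by simp
        then show "\<bar>f n x\<bar> < e" using f01[of n x] e by simp
      qed
    qed
    have lim: "(\<lambda>n. f n \<xi>) \<longlonglongrightarrow> indicator C \<xi>" for \<xi>
    proof (cases "\<xi> \<in> C")
      case True
      have "(\<lambda>n. exp (- (norm \<xi> / real (Suc n)))) \<longlonglongrightarrow> exp (- 0)"
        by (intro tendsto_intros LIMSEQ_Suc lim_const_over_n)
      then show ?thesis using True by (simp add: f_def)
    next
      case False
      then have pos: "0 < infdist \<xi> C"
        using C \<open>C \<noteq> {}\<close> by (metis in_closed_iff_infdist_zero infdist_nonneg less_eq_real_def)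
      obtain N :: nat where N: "1 / infdist \<xi> C < N" using reals_Archimedean2 by blast
      have "f n \<xi> = 0" if "N \<le> n" for n
      proof -
        have "1 / infdist \<xi> C \<le> Suc n" using N that by linarith
        then have "1 - Suc n * infdist \<xi> C \<le> 0" using pos by (simp add: pos_divide_le_eq)
        then show ?thesis unfolding f_def by (simp add: max_absorb1)
      qed
      then have "\<forall>\<^sub>F n in sequentially. f n \<xi> = 0" by (auto simp: eventually_sequentially)
      then show ?thesis using False by (simp add: tendsto_eventually)
    qed
    have int: "(\<lambda>n. \<integral>\<xi>. f n \<xi> \<partial>\<kappa>) \<longlonglongrightarrow> measure \<kappa> (C \<inter> stateD)" if \<kappa>: "\<kappa> \<in> probD" for \<kappa>
    proof -
      interpret prob_space \<kappa> by (rule probDD[OF \<kappa>])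
      have "(\<lambda>n. \<integral>\<xi>. f n \<xi> \<partial>\<kappa>) \<longlonglongrightarrow> (\<integral>\<xi>. indicator C \<xi> \<partial>\<kappa>)"
      proof (rule integral_dominated_convergence[where w = "\<lambda>_. 1"])
        show "indicator C \<in> borel_measurable \<kappa>"
          using C probDD(2)[OF \<kappa>] by (auto cong: measurable_cong_sets intro!: measurable_restrict_space1)
        show "f n \<in> borel_measurable \<kappa>" for n
          by (rule measurableD_continuous[OF cont probD_subprobD[OF \<kappa>]])
        show "AE x in \<kappa>. norm (f n x) \<le> 1" for n
          using f01[of n] by (intro AE_I2) (smt (verit) divide_nonneg_nonneg norm_ge_zero of_nat_0_le_iff one_le_exp_iff exp_le_one_iff real_norm_def)
      qed (use lim in auto)
      then show ?thesis using probDD(3)[OF \<kappa>] by (simp add: Int_commute)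
    qed
    have "measure \<mu> (C \<inter> stateD) = measure \<nu> (C \<inter> stateD)"
      using LIMSEQ_unique[OF int[OF \<mu>]] int[OF \<nu>] eq[OF C0] by simp
    then show ?thesis
      using \<mu> \<nu> by (simp add: probDD(1) finite_measure.emeasure_eq_measure[OF prob_space.finite_measure])
  qed simp
  \<comment> \<open>Pushing forward to the whole plane makes the closed sets a generator of the
    \<sigma>-algebra; equality is pulled back to subsets of \<open>stateD\<close> at the
    end.\<close>
  let ?d = "\<lambda>\<kappa>. distr \<kappa> borel (\<lambda>x. x)"
  have m: "(\<lambda>x. x) \<in> \<kappa> \<rightarrow>\<^sub>M borel" if "\<kappa> \<in> probD" for \<kappa>
    using probDD(2)[OF that] by (auto cong: measurable_cong_sets intro!: measurable_restrict_space1)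
  have em: "emeasure (?d \<kappa>) A = emeasure \<kappa> (A \<inter> stateD)" if "\<kappa> \<in> probD" "A \<in> sets borel" for \<kappa> A
    using emeasure_distr[OF m that(2)] that probDD(3) by auto
  have d: "?d \<mu> = ?d \<nu>"
  proof (rule measure_eqI_generator_eq[where E = "Collect closed" and \<Omega> = UNIV and A = "\<lambda>_. UNIV"])
    show "Int_stable (Collect closed)" by (auto simp: Int_stable_def)
    show "emeasure (?d \<mu>) X = emeasure (?d \<nu>) X" if "X \<in> Collect closed" for X
      using closed_eq[of X] that em \<mu> \<nu> by (simp add: borel_closed)
    show "emeasure (?d \<mu>) UNIV \<noteq> \<infinity>"
      using em[OF \<mu>, of UNIV] prob_space.emeasure_space_1[OF probDD(1)[OF \<mu>]] probDD(3)[OF \<mu>] by simp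
  qed (auto simp: borel_eq_closed)
  show ?thesis
  proof (rule measure_eqI)
    show "sets \<mu> = sets \<nu>" using probDD(2) \<mu> \<nu> by simp
    fix A assume "A \<in> sets \<mu>"
    then have "A \<in> sets borel" "A \<subseteq> stateD"
      using probDD(2)[OF \<mu>] by (auto simp: sets_restrict_space)
    then show "emeasure \<mu> A = emeasure \<nu> A"
      using em[OF \<mu>, of A] em[OF \<nu>, of A] d by (simp add: Int_absorb2)
  qed
qed

text \<open>For constant sequences the comparison of limits becomes an equality of
  integrals.\<close>

lemma transform_unique:
  assumes \<mu>: "\<mu> \<in> probD" and \<nu>: "\<nu> \<in> probD"
    and eq: "\<And>u. u \<in> domU \<Longrightarrow> transform \<mu> u = transform \<nu> u"
  shows "\<mu> = \<nu>"
proof (rule probD_eqI_C0D[OF \<mu> \<nu>])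
  fix f assume "f \<in> C0D"
  from tendsto_integral_diff_transform[of "\<lambda>_. \<mu>" "\<lambda>_. \<nu>", OF _ _ _ this] eq \<mu> \<nu>
  show "(\<integral>\<xi>. f \<xi> \<partial>\<mu>) = (\<integral>\<xi>. f \<xi> \<partial>\<nu>)" by (simp add: LIMSEQ_const_iff probD_subprobD)
qed

section \<open>Convolutions, kernels and point masses\<close>

lemma measurable_plus_borelD: "(\<lambda>(x, y). x + y) \<in> borelD \<Otimes>\<^sub>M borelD \<rightarrow>\<^sub>M borelD"
proof (rule measurable_restrict_space2)
  have id: "(\<lambda>x. x) \<in> borelD \<rightarrow>\<^sub>M borel" by (rule measurable_restrict_space1) simp
  have "(\<lambda>z. fst z + snd z) \<in> borelD \<Otimes>\<^sub>M borelD \<rightarrow>\<^sub>M borel"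
    by (intro borel_measurable_add measurable_compose[OF measurable_fst id] measurable_compose[OF measurable_snd id])
  then show "(\<lambda>(x, y). x + y) \<in> borelD \<Otimes>\<^sub>M borelD \<rightarrow>\<^sub>M borel"
    by (simp add: split_def)
qed (auto simp: space_pair_measure space_restrict_space intro: stateD_add)

text \<open>Sums of points of \<open>stateD\<close> stay in it, so restricting after the
  push-forward amounts to pushing forward into the half plane directly.\<close>

lemma convD_eq_distr:
  assumes "\<mu> \<in> probD" "\<nu> \<in> probD"
  shows "convD \<mu> \<nu> = distr (\<mu> \<Otimes>\<^sub>M \<nu>) borelD (\<lambda>(x, y). x + y)"
proof -
  have s: "sets (\<mu> \<Otimes>\<^sub>M \<nu>) = sets (borelD \<Otimes>\<^sub>M borelD)"
    by (rule sets_pair_measure_cong) (use assms probDD in auto)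
  show ?thesis
    unfolding convD_def convolution_def
    by (rule restrict_distr)
       (use measurable_plus_borelD s assms probDD in \<open>auto cong: measurable_cong_sets
         simp: measurable_restrict_space2_iff space_pair_measure intro: stateD_add\<close>)
qed

lemma convD_in_probD:
  assumes "\<mu> \<in> probD" "\<nu> \<in> probD"
  shows "convD \<mu> \<nu> \<in> probD"
proof -
  have "sets (\<mu> \<Otimes>\<^sub>M \<nu>) = sets (borelD \<Otimes>\<^sub>M borelD)"
    by (rule sets_pair_measure_cong) (use assms probDD in auto)
  then have "prob_space (distr (\<mu> \<Otimes>\<^sub>M \<nu>) borelD (\<lambda>(x, y). x + y))"
    by (intro prob_space.prob_space_distr prob_space_pair probDD(1) assms)
       (use measurable_plus_borelD in \<open>auto cong: measurable_cong_sets\<close>)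
  then show ?thesis
    unfolding convD_eq_distr[OF assms] by (simp add: space_prob_algebra)
qed

lemma transform_convD:
  assumes \<mu>: "\<mu> \<in> probD" and \<nu>: "\<nu> \<in> probD" and u: "u \<in> domU"
  shows "transform (convD \<mu> \<nu>) u = transform \<mu> u * transform \<nu> u"
proof -
  interpret M: prob_space \<mu> by (rule probDD[OF \<mu>])
  interpret N: prob_space \<nu> by (rule probDD[OF \<nu>])
  interpret P: pair_sigma_finite \<mu> \<nu> ..
  have s: "sets (\<mu> \<Otimes>\<^sub>M \<nu>) = sets (borelD \<Otimes>\<^sub>M borelD)"
    by (rule sets_pair_measure_cong) (use assms probDD in auto)
  interpret P': finite_measure "\<mu> \<Otimes>\<^sub>M \<nu>"
    by (intro finite_measure_pair_measure) unfold_locales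
  have int: "integrable (\<mu> \<Otimes>\<^sub>M \<nu>) (\<lambda>z. exp (pairing u (fst z)) * exp (pairing u (snd z)))"
  proof (rule P'.integrable_const_bound[where B = 1])
    show "AE z in \<mu> \<Otimes>\<^sub>M \<nu>. norm (exp (pairing u (fst z)) * exp (pairing u (snd z))) \<le> 1"
      using norm_exp_pairing_le[OF u] probDD(3)[OF \<mu>] probDD(3)[OF \<nu>]
      by (intro AE_I2) (auto simp: norm_mult space_pair_measure simp del: norm_exp_eq_Re intro!: mult_le_one)
    have [measurable]: "(\<lambda>x. exp (pairing u x)) \<in> borel_measurable borelD"
      by (intro borel_measurable_continuous_on_restrict continuous_intros)
    show "(\<lambda>z. exp (pairing u (fst z)) * exp (pairing u (snd z))) \<in> borel_measurable (\<mu> \<Otimes>\<^sub>M \<nu>)"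
      unfolding measurable_cong_sets[OF s refl] by measurable
  qed
  have "transform (convD \<mu> \<nu>) u = (\<integral>z. exp (pairing u (fst z + snd z)) \<partial>(\<mu> \<Otimes>\<^sub>M \<nu>))"
    unfolding transform_def convD_eq_distr[OF \<mu> \<nu>]
    by (subst integral_distr)
       (use measurable_plus_borelD s in \<open>auto simp: split_def cong: measurable_cong_sets
          intro!: borel_measurable_continuous_on_restrict continuous_intros\<close>)
  also have "\<dots> = (\<integral>z. exp (pairing u (fst z)) * exp (pairing u (snd z)) \<partial>(\<mu> \<Otimes>\<^sub>M \<nu>))"
    by (simp add: pairing_add_right exp_add)
  also have "\<dots> = (\<integral>x. (\<integral>y. exp (pairing u x) * exp (pairing u y) \<partial>\<nu>) \<partial>\<mu>)"
    using P.integral_fst'[OF int] by simp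
  also have "\<dots> = transform \<mu> u * transform \<nu> u"
    by (simp add: transform_def)
  finally show ?thesis .
qed

lemma integral_bind_real:
  fixes f :: "real \<times> real \<Rightarrow> real"
  assumes \<mu>: "\<mu> \<in> probD" and K: "K \<in> borelD \<rightarrow>\<^sub>M prob_algebra borelD"
    and f: "f \<in> borel_measurable borelD" "\<And>x. x \<in> stateD \<Longrightarrow> \<bar>f x\<bar> \<le> B"
  shows "(\<integral>x. f x \<partial>(\<mu> \<bind> K)) = (\<integral>x. (\<integral>y. f y \<partial>K x) \<partial>\<mu>)"
proof -
  interpret prob_space \<mu> by (rule probDD[OF \<mu>])
  have K': "K \<in> \<mu> \<rightarrow>\<^sub>M subprob_algebra borelD"
    using measurable_prob_algebraD[OF K] probDD(2)[OF \<mu>] by (simp cong: measurable_cong_sets)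
  have "\<mu> \<bind> K = join (distr \<mu> (subprob_algebra borelD) K)"
    by (rule bind_nonempty''[OF K' not_empty])
  also have "(\<integral>x. f x \<partial>\<dots>) = (\<integral>M. (\<integral>y. f y \<partial>M) \<partial>distr \<mu> (subprob_algebra borelD) K)"
  proof (rule integral_join[where B = B and B' = 1, OF f(1)])
    show "finite_measure (distr \<mu> (subprob_algebra borelD) K)"
      by (rule finite_measure_distr[OF K'])
    show "AE M in distr \<mu> (subprob_algebra borelD) K. emeasure M (space M) \<le> ennreal 1"
      by (intro AE_I2) (auto simp: space_subprob_algebra dest: subprob_space.emeasure_space_le_1)
  qed (use f(2) in \<open>auto simp: space_restrict_space\<close>)
  also have "\<dots> = (\<integral>x. (\<integral>y. f y \<partial>K x) \<partial>\<mu>)"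
    by (rule integral_distr[OF K' integral_measurable_subprob_algebra[OF f(1)]])
  finally show ?thesis .
qed

text \<open>The real and imaginary parts of the exponential are bounded by one on
  \<open>stateD\<close>, so each falls under \<open>integral_bind_real\<close>.\<close>

lemma transform_bind:
  assumes \<mu>: "\<mu> \<in> probD" and K: "K \<in> borelD \<rightarrow>\<^sub>M prob_algebra borelD" and u: "u \<in> domU"
  shows "transform (\<mu> \<bind> K) u = (\<integral>x. transform (K x) u \<partial>\<mu>)"
proof -
  interpret prob_space \<mu> by (rule probDD[OF \<mu>])
  have Kx: "K x \<in> probD" if "x \<in> stateD" for x
    using measurable_space[OF K, of x] that by (simp add: space_restrict_space)
  have bind: "\<mu> \<bind> K \<in> probD"
    using prob_space_bind'[OF \<mu> K] sets_bind'[OF \<mu> K] by (simp add: space_prob_algebra)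
  let ?e = "\<lambda>\<xi>. exp (pairing u \<xi>)"
  have e: "?e \<in> borel_measurable borelD"
    by (intro borel_measurable_continuous_on_restrict continuous_intros)
  have K': "K \<in> \<mu> \<rightarrow>\<^sub>M subprob_algebra borelD"
    using measurable_prob_algebraD[OF K] probDD(2)[OF \<mu>] by (simp cong: measurable_cong_sets)
  have int: "integrable \<mu> (\<lambda>x. transform (K x) u)"
  proof (rule integrable_const_bound[where B = 1])
    show "(\<lambda>x. transform (K x) u) \<in> borel_measurable \<mu>"
      unfolding transform_def
      by (rule measurable_compose[OF K' integral_measurable_subprob_algebra[OF e]])
  qed (use norm_transform_le[OF u probD_subprobD[OF Kx]] probDD(3)[OF \<mu>] in \<open>auto intro!: AE_I2\<close>)
  have bd: "\<bar>Re (?e x)\<bar> \<le> 1" "\<bar>Im (?e x)\<bar> \<le> 1" if "x \<in> stateD" for x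
    using norm_exp_pairing_le[OF u that] abs_Re_le_cmod[of "?e x"] abs_Im_le_cmod[of "?e x"] by linarith+
  have ie: "integrable \<kappa> ?e" if "\<kappa> \<in> probD" for \<kappa>
    by (rule integrable_exp_pairing[OF u probD_subprobD[OF that]])
  have "Re (transform (\<mu> \<bind> K) u) = (\<integral>x. Re (?e x) \<partial>(\<mu> \<bind> K))"
    unfolding transform_def using ie[OF bind] by (rule integral_Re[symmetric])
  also have "\<dots> = (\<integral>x. (\<integral>y. Re (?e y) \<partial>K x) \<partial>\<mu>)"
    using e bd(1) by (intro integral_bind_real[OF \<mu> K, where B = 1]) auto
  also have "\<dots> = (\<integral>x. Re (transform (K x) u) \<partial>\<mu>)"
    unfolding transform_def
    by (intro Bochner_Integration.integral_cong refl integral_Re ie Kx) (use probDD(3)[OF \<mu>] in auto)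
  also have "\<dots> = Re (\<integral>x. transform (K x) u \<partial>\<mu>)" by (rule integral_Re[OF int])
  finally have re: "Re (transform (\<mu> \<bind> K) u) = Re (\<integral>x. transform (K x) u \<partial>\<mu>)" .
  have "Im (transform (\<mu> \<bind> K) u) = (\<integral>x. Im (?e x) \<partial>(\<mu> \<bind> K))"
    unfolding transform_def using ie[OF bind] by (rule integral_Im[symmetric])
  also have "\<dots> = (\<integral>x. (\<integral>y. Im (?e y) \<partial>K x) \<partial>\<mu>)"
    using e bd(2) by (intro integral_bind_real[OF \<mu> K, where B = 1]) auto
  also have "\<dots> = (\<integral>x. Im (transform (K x) u) \<partial>\<mu>)"
    unfolding transform_def
    by (intro Bochner_Integration.integral_cong refl integral_Im ie Kx) (use probDD(3)[OF \<mu>] in auto)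
  also have "\<dots> = Im (\<integral>x. transform (K x) u \<partial>\<mu>)" by (rule integral_Im[OF int])
  finally show ?thesis using re by (simp add: complex_eq_iff)
qed

lemma bind_in_probD:
  "\<mu> \<in> probD \<Longrightarrow> K \<in> borelD \<rightarrow>\<^sub>M prob_algebra borelD \<Longrightarrow> \<mu> \<bind> K \<in> probD"
  using prob_space_bind'[of \<mu> borelD K borelD] sets_bind'[of \<mu> borelD K borelD]
  by (simp add: space_prob_algebra)

lemma transform_return:
  assumes "x \<in> stateD"
  shows "transform (return borelD x) u = exp (pairing u x)"
  unfolding transform_def
  by (rule integral_return)
     (use assms in \<open>auto simp: space_restrict_space intro!: borel_measurable_continuous_on_restrict continuous_intros\<close>)

lemma return_in_probD: "x \<in> stateD \<Longrightarrow> return borelD x \<in> probD"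
  by (auto simp: space_prob_algebra space_restrict_space intro!: prob_space_return)

section \<open>Exponents and zeros of transforms\<close>

text \<open>Integrating the characters against a standard normal weight turns their convergence into
  \<open>exp (- (h n - a)\<^sup>2 / 2) \<longlonglongrightarrow> 1\<close>.\<close>

lemma tendsto_of_characters:
  fixes h :: "nat \<Rightarrow> real"
  assumes lim: "\<And>s. 0 \<le> s \<Longrightarrow> (\<lambda>n. exp (\<i> * of_real (s * h n))) \<longlonglongrightarrow> exp (\<i> * of_real (s * a))"
  shows "h \<longlonglongrightarrow> a"
proof -
  interpret N: prob_space std_normal_distribution by (rule prob_space_std_normal)
  have pos: "(\<lambda>n. exp (\<i> * of_real (s * (h n - a)))) \<longlonglongrightarrow> 1" if "0 \<le> s" for s
  proof -
    have "(\<lambda>n. exp (\<i> * of_real (s * h n)) / exp (\<i> * of_real (s * a))) \<longlonglongrightarrow> 1"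
      using tendsto_divide[OF lim[OF that] tendsto_const, of "exp (\<i> * of_real (s * a))"] by simp
    then show ?thesis by (simp add: exp_diff[symmetric] algebra_simps)
  qed
  \<comment> \<open>The normal law also charges negative frequencies; these follow by taking
    inverses.\<close>
  have all: "(\<lambda>n. exp (\<i> * of_real (s * (h n - a)))) \<longlonglongrightarrow> 1" for s
  proof (cases "0 \<le> s")
    case False
    then have "(\<lambda>n. inverse (exp (\<i> * of_real (- s * (h n - a))))) \<longlonglongrightarrow> inverse 1"
      by (intro tendsto_inverse pos) auto
    then show ?thesis by (simp add: exp_minus[symmetric])
  qed (rule pos)
  have "(\<lambda>n. \<integral>z. exp (\<i> * of_real (z * (h n - a))) \<partial>std_normal_distribution)
      \<longlonglongrightarrow> (\<integral>z. 1 \<partial>std_normal_distribution)"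
    by (rule integral_dominated_convergence[where w = "\<lambda>_. 1"]) (use all in auto)
  moreover have "(\<integral>z. 1 \<partial>std_normal_distribution) = (of_real 1 :: complex)"
    using N.prob_space by simp
  ultimately have "(\<lambda>n. of_real (exp (- (h n - a)\<^sup>2 / 2)) :: complex) \<longlonglongrightarrow> of_real 1"
    unfolding integral_std_normal_exp by (simp only:)
  then have "(\<lambda>n. exp (- (h n - a)\<^sup>2 / 2)) \<longlonglongrightarrow> 1"
    unfolding tendsto_of_real_iff .
  then have "(\<lambda>n. ln (exp (- (h n - a)\<^sup>2 / 2))) \<longlonglongrightarrow> ln 1"
    by (rule tendsto_ln) simp
  then have "(\<lambda>n. - 2 * (- (h n - a)\<^sup>2 / 2)) \<longlonglongrightarrow> - 2 * 0"
    by (intro tendsto_mult tendsto_const) simp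
  then have "(\<lambda>n. (h n - a)\<^sup>2) \<longlonglongrightarrow> 0" by simp
  then have "(\<lambda>n. h n - a) \<longlonglongrightarrow> 0"
    using tendsto_real_sqrt[of "\<lambda>n. (h n - a)\<^sup>2" 0 sequentially] tendsto_rabs_zero_cancel by simp
  then show ?thesis by (simp add: LIM_zero_iff)
qed

text \<open>At s = 1 the moduli give convergence of the real parts. Dividing the moduli out leaves
  characters of the imaginary parts, and having all scales \<open>s\<close> removes the ambiguity
  modulo 2 pi.\<close>

lemma tendsto_of_exp_scaled:
  fixes a :: "nat \<Rightarrow> complex"
  assumes lim: "\<And>s. 0 \<le> s \<Longrightarrow> (\<lambda>n. exp (a n * of_real s)) \<longlonglongrightarrow> exp (b * of_real s)"
  shows "a \<longlonglongrightarrow> b"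
proof -
  have "(\<lambda>n. ln (norm (exp (a n * of_real 1)))) \<longlonglongrightarrow> ln (norm (exp (b * of_real 1)))"
    by (intro tendsto_ln tendsto_norm lim) auto
  then have re: "(\<lambda>n. Re (a n)) \<longlonglongrightarrow> Re b" by simp
  have split: "exp (\<i> * of_real (s * Im z)) = exp (z * of_real s) / of_real (exp (s * Re z))" for s z
  proof -
    have "z * of_real s = of_real (s * Re z) + \<i> * of_real (s * Im z)"
      by (simp add: complex_eq_iff)
    then show ?thesis by (simp only: exp_add exp_of_real) (simp del: of_real_mult)
  qed
  have "(\<lambda>n. Im (a n)) \<longlonglongrightarrow> Im b"
  proof (rule tendsto_of_characters)
    fix s :: real assume "0 \<le> s"
    then show "(\<lambda>n. exp (\<i> * of_real (s * Im (a n)))) \<longlonglongrightarrow> exp (\<i> * of_real (s * Im b))"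
      unfolding split by (intro tendsto_intros lim re) simp_all
  qed
  with re show ?thesis by (simp add: tendsto_complex_iff)
qed

lemma eq_of_exp_scaled:
  fixes a b :: complex
  assumes "\<And>s. 0 \<le> s \<Longrightarrow> exp (a * of_real s) = exp (b * of_real s)"
  shows "a = b"
  using tendsto_of_exp_scaled[of "\<lambda>_. a" b] assms by (simp add: LIMSEQ_const_iff)

section \<open>Halving and additivity for real functions\<close>

lemma nonzero_of_halving:
  fixes f :: "real \<Rightarrow> real"
  assumes cont: "continuous_on {0..} f" and "f 0 \<noteq> 0"
    and half: "\<And>t. 0 \<le> t \<Longrightarrow> f t = 0 \<Longrightarrow> f (t / 2) = 0" and t: "0 \<le> t"
  shows "f t \<noteq> 0"
proof
  assume "f t = 0"
  then have z: "f (t / 2 ^ n) = 0" for n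
  proof (induction n)
    case (Suc n)
    then show ?case using half[of "t / 2 ^ n"] t by (simp add: mult.commute)
  qed simp
  have "(\<lambda>n. t / 2 ^ n) \<longlonglongrightarrow> 0"
    using tendsto_mult_right_zero[OF LIMSEQ_inverse_realpow_zero[of 2], of t] by (simp add: divide_inverse)
  then have "(\<lambda>n. f (t / 2 ^ n)) \<longlonglongrightarrow> f 0"
    using t cont[unfolded continuous_on_sequentially comp_def, rule_format, of 0 "\<lambda>n. t / 2 ^ n"] by simp
  with z \<open>f 0 \<noteq> 0\<close> show False by (simp add: LIMSEQ_const_iff)
qed

text \<open>Cauchy's functional equation: additivity gives homogeneity over the rationals, and the
  approximations \<open>q n\<close> from below carry it to \<open>y\<close>.\<close>

lemma continuous_additive_real:
  fixes h :: "real \<Rightarrow> real"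
  assumes add: "\<And>x y. h (x + y) = h x + h y" and cont: "continuous_on UNIV h"
  shows "h y = h 1 * y"
proof -
  have h0: "h 0 = 0" using add[of 0 0] by simp
  have nat: "h (real n * x) = real n * h x" for n x
    by (induction n) (simp_all add: h0 add distrib_right)
  have neg: "h (- x) = - h x" for x using add[of x "- x"] h0 by simp
  have int: "h (of_int k * x) = of_int k * h x" for k x
  proof (cases "0 \<le> k")
    case True
    then show ?thesis using nat[of "nat k" x] by simp
  next
    case False
    then show ?thesis using nat[of "nat (- k)" x] neg[of "of_int k * x"] by simp
  qed
  have div: "h (of_int k / Suc n) = h 1 * (of_int k / Suc n)" for k n
    using int[of k "1 / Suc n"] nat[of "Suc n" "1 / Suc n"] by (simp add: field_simps)
  define q where "q n = of_int \<lfloor>y * Suc n\<rfloor> / real (Suc n)" for n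
  have "q \<longlonglongrightarrow> y"
  proof (rule tendsto_sandwich)
    have "(\<lambda>n. y - 1 / real (Suc n)) \<longlonglongrightarrow> y - 0"
      by (intro tendsto_intros LIMSEQ_Suc[OF lim_1_over_n])
    then show "(\<lambda>n. y - 1 / real (Suc n)) \<longlonglongrightarrow> y" by simp
    show "\<forall>\<^sub>F n in sequentially. y - 1 / real (Suc n) \<le> q n"
    proof (intro always_eventually allI)
      fix n
      have "y * Suc n - 1 \<le> of_int \<lfloor>y * Suc n\<rfloor>" by linarith
      then have "(y * Suc n - 1) / Suc n \<le> q n" unfolding q_def by (rule divide_right_mono) simp
      then show "y - 1 / real (Suc n) \<le> q n" by (simp add: diff_divide_distrib)
    qed
    show "\<forall>\<^sub>F n in sequentially. q n \<le> y"
      by (intro always_eventually allI) (simp add: q_def pos_divide_le_eq)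
  qed simp
  then have "(\<lambda>n. h (q n)) \<longlonglongrightarrow> h y" "(\<lambda>n. h 1 * q n) \<longlonglongrightarrow> h 1 * y"
    using cont by (auto simp: continuous_on_sequentially comp_def intro: tendsto_mult_left)
  moreover have "h (q n) = h 1 * q n" for n unfolding q_def by (rule div)
  ultimately show ?thesis by (simp add: LIMSEQ_unique)
qed

section \<open>Continuity in time and transforms of modulus one\<close>

text \<open>Weak continuity is tested on real functions, so the exponential enters through its real
  and imaginary parts.\<close>

lemma continuous_on_transform_time:
  assumes wc: "weakly_continuous \<mu>" and \<mu>: "\<And>t. 0 \<le> t \<Longrightarrow> \<mu> t \<in> probD" and u: "u \<in> domU"
  shows "continuous_on {0..} (\<lambda>t. transform (\<mu> t) u)"
proof -
  let ?e = "\<lambda>\<xi>. exp (pairing u \<xi>)"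
  have bd: "norm (?e x) \<le> 1" if "x \<in> stateD" for x using norm_exp_pairing_le[OF u that] .
  have re: "continuous_on {0..} (\<lambda>t. \<integral>\<xi>. Re (?e \<xi>) \<partial>(\<mu> t))"
  proof (rule wc[unfolded weakly_continuous_def, rule_format])
    show "continuous_on stateD (\<lambda>\<xi>. Re (?e \<xi>))" by (intro continuous_intros)
    show "bounded ((\<lambda>\<xi>. Re (?e \<xi>)) ` stateD)"
      using bd abs_Re_le_cmod order_trans by (intro boundedI[where B = 1]) (auto simp del: norm_exp_eq_Re, blast)
  qed
  have im: "continuous_on {0..} (\<lambda>t. \<integral>\<xi>. Im (?e \<xi>) \<partial>(\<mu> t))"
  proof (rule wc[unfolded weakly_continuous_def, rule_format])
    show "continuous_on stateD (\<lambda>\<xi>. Im (?e \<xi>))" by (intro continuous_intros)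
    show "bounded ((\<lambda>\<xi>. Im (?e \<xi>)) ` stateD)"
      using bd abs_Im_le_cmod order_trans by (intro boundedI[where B = 1]) (auto simp del: norm_exp_eq_Re, blast)
  qed
  have eq: "Complex (\<integral>\<xi>. Re (?e \<xi>) \<partial>(\<mu> t)) (\<integral>\<xi>. Im (?e \<xi>) \<partial>(\<mu> t)) = transform (\<mu> t) u" if "0 \<le> t" for t
    using integrable_exp_pairing[OF u probD_subprobD[OF \<mu>[OF that]]]
    by (simp add: transform_def complex_eq_iff del: Re_exp Im_exp)
  have "continuous_on {0..} (\<lambda>t. Complex (\<integral>\<xi>. Re (?e \<xi>) \<partial>(\<mu> t)) (\<integral>\<xi>. Im (?e \<xi>) \<partial>(\<mu> t)))"
    unfolding Complex_eq by (intro continuous_intros re im)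
  then show ?thesis by (rule continuous_on_eq) (use eq in auto)
qed

text \<open>The equality case of the triangle inequality: after rotation by the conjugate of the
  mean \<open>?c\<close>, the nonnegative function 1 - Re has integral zero, and modulus at most one
  with real part one leaves only the value one.\<close>

lemma transform_unit_modulus:
  assumes \<mu>: "\<mu> \<in> probD" and u: "u \<in> domU" and n: "norm (transform \<mu> u) = 1"
  shows "AE \<xi> in \<mu>. exp (pairing u \<xi>) = transform \<mu> u"
proof -
  interpret prob_space \<mu> by (rule probDD[OF \<mu>])
  let ?e = "\<lambda>\<xi>. exp (pairing u \<xi>)" and ?c = "transform \<mu> u"
  have int: "integrable \<mu> ?e" by (rule integrable_exp_pairing[OF u probD_subprobD[OF \<mu>]])
  have int': "integrable \<mu> (\<lambda>\<xi>. 1 - Re (cnj ?c * ?e \<xi>))"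
    using int by (intro Bochner_Integration.integrable_diff integrable_Re integrable_mult_right) auto
  have le: "norm (cnj ?c * ?e \<xi>) \<le> 1" if "\<xi> \<in> stateD" for \<xi>
    using norm_exp_pairing_le[OF u that] n by (simp add: norm_mult)
  have "(\<integral>\<xi>. 1 - Re (cnj ?c * ?e \<xi>) \<partial>\<mu>) = (\<integral>\<xi>. 1 \<partial>\<mu>) - (\<integral>\<xi>. Re (cnj ?c * ?e \<xi>) \<partial>\<mu>)"
    using int by (intro Bochner_Integration.integral_diff integrable_Re integrable_mult_right) auto
  also have "(\<integral>\<xi>. Re (cnj ?c * ?e \<xi>) \<partial>\<mu>) = Re (\<integral>\<xi>. cnj ?c * ?e \<xi> \<partial>\<mu>)"
    using int by (intro integral_Re integrable_mult_right)
  also have "(\<integral>\<xi>. cnj ?c * ?e \<xi> \<partial>\<mu>) = cnj ?c * ?c"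
    unfolding transform_def by (rule integral_mult_right_zero)
  also have "cnj ?c * ?c = 1"
    using complex_norm_square[of ?c] n by (simp add: mult.commute)
  finally have "(\<integral>\<xi>. 1 - Re (cnj ?c * ?e \<xi>) \<partial>\<mu>) = 0" by (simp add: prob_space)
  moreover have "AE \<xi> in \<mu>. 0 \<le> 1 - Re (cnj ?c * ?e \<xi>)"
    using le complex_Re_le_cmod order_trans probDD(3)[OF \<mu>] by (intro AE_I2) (simp del: times_complex.simps, blast)
  ultimately have "AE \<xi> in \<mu>. 1 - Re (cnj ?c * ?e \<xi>) = 0"
    using integral_nonneg_eq_0_iff_AE[OF int'] by blast
  then show ?thesis
    using AE_space
  proof eventually_elim
    case (elim \<xi>)
    let ?z = "cnj ?c * ?e \<xi>"
    have "norm ?z \<le> 1" using le elim(2) probDD(3)[OF \<mu>] by simp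
    moreover have "Re ?z = 1" using elim(1) by linarith
    ultimately have "(Im ?z)\<^sup>2 \<le> 0" using cmod_power2[of ?z] power_le_one[of "norm ?z" 2] by simp
    then have "?z = 1" using \<open>Re ?z = 1\<close> by (simp add: complex_eq_iff)
    then have "?c * ?z = ?c" by simp
    moreover have "?c * cnj ?c = 1" using complex_norm_square[of ?c] n by simp
    ultimately show ?case by (metis mult.assoc mult_1)
  qed
qed

text \<open>Taking moduli in \<open>transform_unit_modulus\<close> leaves exp(Re u1 * \<xi>1) = 1,
  with Re u1 nonzero.\<close>

lemma AE_fst_eq_0:
  assumes \<mu>: "\<mu> \<in> probD" and u: "u \<in> domU" "Re (fst u) < 0" and n: "norm (transform \<mu> u) = 1"
  shows "AE \<xi> in \<mu>. fst \<xi> = 0"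
  using transform_unit_modulus[OF \<mu> u(1) n]
proof eventually_elim
  case (elim \<xi>)
  then have "exp (Re (fst u) * fst \<xi>) = 1"
    using n Re_pairing[OF u(1), of \<xi>] by (metis norm_exp_eq_Re)
  then show ?case using u(2) by simp
qed

lemma transform_cong_AE:
  assumes "\<mu> \<in> probD" "AE \<xi> in \<mu>. exp (pairing u \<xi>) = exp (pairing v \<xi>)"
  shows "transform \<mu> u = transform \<mu> v"
  unfolding transform_def
  by (rule integral_cong_AE) (use assms probD_subprobD in \<open>auto intro!: measurableD_continuous continuous_intros\<close>)

section \<open>Homogeneous affine and skew convolution semigroups\<close>

lemma pairing_axes: "pairing u (s, 0) = fst u * of_real s" "pairing u (0, s) = snd u * of_real s"
  by (simp_all add: pairing_def)

lemma axes_stateD: "0 \<le> s \<Longrightarrow> (s, 0) \<in> stateD" "(0, s) \<in> stateD"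
  by (simp_all add: stateD_def)

text \<open>The mean value bound on a convex half plane where the derivative of exp has modulus at
  most one.\<close>

lemma norm_exp_minus_1_le:
  assumes "Re z \<le> 0"
  shows "norm (exp z - 1) \<le> norm z"
proof -
  have "norm (exp z - exp 0) \<le> 1 * norm (z - 0)"
    by (rule field_differentiable_bound[where S = "{z. Re z \<le> 0}" and f' = exp])
       (use assms in \<open>auto intro!: convex_halfspace_Re_le DERIV_exp has_field_derivative_at_within\<close>)
  then show ?thesis by simp
qed

lemma norm_pairing_le: "norm (pairing u x) \<le> 2 * norm u * norm x"
proof -
  have "norm (pairing u x) \<le> norm (fst u) * norm (fst x) + norm (snd u) * norm (snd x)"
    unfolding pairing_def by (rule order_trans[OF norm_triangle_ineq]) (simp add: norm_mult)
  also have "\<dots> \<le> norm u * norm x + norm u * norm x"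
    using norm_fst_le[of "fst u" "snd u"] norm_snd_le[of "snd u" "fst u"]
      norm_fst_le[of "fst x" "snd x"] norm_snd_le[of "snd x" "fst x"]
    by (intro add_mono mult_mono) auto
  finally show ?thesis by (simp add: mult.commute mult.left_commute)
qed

locale affine_setting =
  fixes Q P :: "real \<Rightarrow> real \<times> real \<Rightarrow> (real \<times> real) measure"
    and \<psi> :: "real \<Rightarrow> complex \<times> complex \<Rightarrow> complex \<times> complex"
    and \<gamma> :: "real \<Rightarrow> (real \<times> real) measure"
  assumes reg: "regular_HA_semigroup Q \<psi>"
    and SC: "SC_semigroup Q \<gamma>"
    and wc: "weakly_continuous \<gamma>"
    and P_eq: "\<And>t x. 0 \<le> t \<Longrightarrow> x \<in> stateD \<Longrightarrow> P t x = convD (Q t x) (\<gamma> t)"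
begin

section \<open>The flow of the exponent\<close>

lemma HA: "HA_semigroup Q \<psi>"
  using reg by (simp add: regular_HA_semigroup_def)

lemma Q_measurable: "0 \<le> t \<Longrightarrow> Q t \<in> borelD \<rightarrow>\<^sub>M prob_algebra borelD"
  and Q_0: "x \<in> stateD \<Longrightarrow> Q 0 x = return borelD x"
  and Q_add: "0 \<le> r \<Longrightarrow> 0 \<le> t \<Longrightarrow> x \<in> stateD \<Longrightarrow> Q (r + t) x = Q r x \<bind> Q t"
  using HA by (auto simp: HA_semigroup_def transition_semigroup_def)

lemma Q_probD: "0 \<le> t \<Longrightarrow> x \<in> stateD \<Longrightarrow> Q t x \<in> probD"
  using measurable_space[OF Q_measurable, of t x] by (simp add: space_restrict_space)

lemma transform_Q:
  "0 \<le> t \<Longrightarrow> x \<in> stateD \<Longrightarrow> u \<in> domU \<Longrightarrow> transform (Q t x) u = exp (pairing (\<psi> t u) x)"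
  using HA by (simp add: HA_semigroup_def transform_def)

lemma continuous_on_\<psi>: "0 \<le> t \<Longrightarrow> continuous_on domU (\<psi> t)"
  using HA by (simp add: HA_semigroup_def)

lemma \<psi>_domU:
  assumes "0 \<le> t" "u \<in> domU"
  shows "\<psi> t u \<in> domU"
proof -
  have "Re (pairing (\<psi> t u) x) \<le> 0" if "x \<in> stateD" for x
    using norm_transform_le[OF assms(2) probD_subprobD[OF Q_probD[OF assms(1) that]]]
      transform_Q[OF assms(1) that assms(2)] by simp
  \<comment> \<open>The first point bounds the real part of the first component; the two opposite
    points force the real part of the second to be zero.\<close>
  from this[of "(1, 0)"] this[of "(0, 1)"] this[of "(0, -1)"] show ?thesis
    by (simp add: domU_def stateD_def pairing_def)
qed

lemma eq_of_exp_pairing: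
  assumes "\<And>x. x \<in> stateD \<Longrightarrow> exp (pairing v x) = exp (pairing w x)"
  shows "v = w"
proof (rule prod_eqI)
  show "fst v = fst w"
    by (rule eq_of_exp_scaled) (use assms[OF axes_stateD(1)] in \<open>simp only: pairing_axes\<close>)
  show "snd v = snd w"
    by (rule eq_of_exp_scaled) (use assms[OF axes_stateD(2)] in \<open>simp only: pairing_axes\<close>)
qed

lemma \<psi>_0:
  assumes u: "u \<in> domU"
  shows "\<psi> 0 u = u"
proof (rule eq_of_exp_pairing)
  fix x assume x: "x \<in> stateD"
  show "exp (pairing (\<psi> 0 u) x) = exp (pairing u x)"
    using transform_Q[OF order_refl x u] transform_return[OF x, of u] unfolding Q_0[OF x] by simp
qed

lemma transform_bind_Q:
  assumes "0 \<le> t" "\<mu> \<in> probD" "u \<in> domU"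
  shows "transform (\<mu> \<bind> Q t) u = transform \<mu> (\<psi> t u)"
proof -
  have "transform (\<mu> \<bind> Q t) u = (\<integral>x. transform (Q t x) u \<partial>\<mu>)"
    by (rule transform_bind[OF assms(2) Q_measurable[OF assms(1)] assms(3)])
  also have "\<dots> = transform \<mu> (\<psi> t u)"
    unfolding transform_def[of \<mu>]
    by (intro Bochner_Integration.integral_cong refl transform_Q assms) (use probDD(3)[OF assms(2)] in auto)
  finally show ?thesis .
qed

lemma \<psi>_add:
  assumes "0 \<le> r" "0 \<le> t" and u: "u \<in> domU"
  shows "\<psi> (r + t) u = \<psi> r (\<psi> t u)"
proof (rule eq_of_exp_pairing)
  fix x assume x: "x \<in> stateD"
  have "exp (pairing (\<psi> (r + t) u) x) = transform (Q r x \<bind> Q t) u"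
    using assms x by (simp add: transform_Q flip: Q_add)
  also have "\<dots> = exp (pairing (\<psi> r (\<psi> t u)) x)"
    using assms x by (simp add: transform_bind_Q Q_probD transform_Q \<psi>_domU)
  finally show "exp (pairing (\<psi> (r + t) u) x) = exp (pairing (\<psi> r (\<psi> t u)) x)" .
qed

lemma continuous_on_\<psi>_time:
  assumes u: "u \<in> domU"
  shows "continuous_on {0..} (\<lambda>t. \<psi> t u)"
  unfolding continuous_on_sequentially comp_def
proof safe
  fix r :: "nat \<Rightarrow> real" and t
  assume r: "0 \<le> t" "\<forall>n. r n \<in> {0..}" "r \<longlonglongrightarrow> t"
  have lim: "(\<lambda>n. exp (pairing (\<psi> (r n) u) x)) \<longlonglongrightarrow> exp (pairing (\<psi> t u) x)" if x: "x \<in> stateD" for x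
  proof -
    have "weakly_continuous (\<lambda>t. Q t x)"
      using reg x by (simp add: regular_HA_semigroup_def)
    from continuous_on_transform_time[OF this Q_probD[OF _ x] u]
    have "(\<lambda>n. transform (Q (r n) x) u) \<longlonglongrightarrow> transform (Q t x) u"
      by (rule continuous_on_tendsto_compose) (use r in auto)
    moreover have "transform (Q (r n) x) u = exp (pairing (\<psi> (r n) u) x)" for n
      using r x u by (intro transform_Q) auto
    ultimately show ?thesis using r x u by (simp only: transform_Q)
  qed
  have "(\<lambda>n. fst (\<psi> (r n) u)) \<longlonglongrightarrow> fst (\<psi> t u)"
    by (rule tendsto_of_exp_scaled) (use lim[OF axes_stateD(1)] in \<open>simp only: pairing_axes\<close>)
  moreover have "(\<lambda>n. snd (\<psi> (r n) u)) \<longlonglongrightarrow> snd (\<psi> t u)"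
    by (rule tendsto_of_exp_scaled) (use lim[OF axes_stateD(2)] in \<open>simp only: pairing_axes\<close>)
  ultimately have "(\<lambda>n. (fst (\<psi> (r n) u), snd (\<psi> (r n) u))) \<longlonglongrightarrow> (fst (\<psi> t u), snd (\<psi> t u))"
    by (rule tendsto_Pair)
  then show "(\<lambda>n. \<psi> (r n) u) \<longlonglongrightarrow> \<psi> t u" by simp
qed

section \<open>Linearity of the second component\<close>

text \<open>A starting point with vanishing first coordinate sees only the second component of the
  exponent, which is imaginary by \<open>\<psi>_domU\<close>.\<close>

lemma norm_transform_Q_snd:
  assumes "0 \<le> t" "u \<in> domU"
  shows "norm (transform (Q t (0, s)) u) = 1"
  using \<psi>_domU[OF assms] assms by (simp add: transform_Q axes_stateD pairing_axes domU_def)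

lemma Q_snd_AE:
  assumes "0 \<le> t"
  shows "AE \<xi> in Q t (0, s). fst \<xi> = 0"
  using assms norm_transform_Q_snd[of t "(-1, 0)"]
  by (intro AE_fst_eq_0[where u = "(-1, 0)"] Q_probD axes_stateD) (auto simp: domU_def)

text \<open>Started on the axis where the first coordinate is zero, \<open>Q\<close> stays there
  almost surely, so its transform cannot see the first argument.\<close>

lemma \<psi>_snd_eq:
  assumes t: "0 \<le> t" and u: "(a, w) \<in> domU"
  shows "snd (\<psi> t (a, w)) = snd (\<psi> t (0, w))"
proof (rule eq_of_exp_scaled)
  fix s :: real
  have u0: "(0, w) \<in> domU" using u by (simp add: domU_def)
  have "AE \<xi> in Q t (0, s). exp (pairing (a, w) \<xi>) = exp (pairing (0, w) \<xi>)"
    using Q_snd_AE[OF t] by eventually_elim (simp add: pairing_def)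
  then have "transform (Q t (0, s)) (a, w) = transform (Q t (0, s)) (0, w)"
    by (rule transform_cong_AE[OF Q_probD[OF t axes_stateD(2)]])
  then show "exp (snd (\<psi> t (a, w)) * of_real s) = exp (snd (\<psi> t (0, w)) * of_real s)"
    by (simp add: transform_Q t u u0 axes_stateD pairing_axes)
qed

lemma domU_add: "u \<in> domU \<Longrightarrow> v \<in> domU \<Longrightarrow> u + v \<in> domU"
  by (simp add: domU_def)

lemma \<psi>_snd_add:
  assumes t: "0 \<le> t" and u: "u \<in> domU" and v: "v \<in> domU"
  shows "snd (\<psi> t (u + v)) = snd (\<psi> t u) + snd (\<psi> t v)"
proof (rule eq_of_exp_scaled)
  fix s :: real
  let ?q = "Q t (0, s)"
  have q: "?q \<in> probD" by (rule Q_probD[OF t axes_stateD(2)])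
  interpret prob_space ?q by (rule probDD(1)[OF q])
  \<comment> \<open>All three characters are almost surely equal to their means. The resulting
    identity does not involve \<xi>, so under a probability measure it holds outright.\<close>
  have "AE \<xi> in ?q. transform ?q (u + v) = transform ?q u * transform ?q v"
    using transform_unit_modulus[OF q u norm_transform_Q_snd[OF t u]]
      transform_unit_modulus[OF q v norm_transform_Q_snd[OF t v]]
      transform_unit_modulus[OF q domU_add[OF u v] norm_transform_Q_snd[OF t domU_add[OF u v]]]
    by eventually_elim (metis exp_add pairing_add_left)
  then have "transform ?q (u + v) = transform ?q u * transform ?q v" by simp
  then show "exp (snd (\<psi> t (u + v)) * of_real s) = exp ((snd (\<psi> t u) + snd (\<psi> t v)) * of_real s)"
    by (simp add: transform_Q t u v domU_add axes_stateD pairing_axes distrib_right exp_add)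
qed

text \<open>The coefficient b(t) of the linear second component, read off at the imaginary unit;
  \<open>\<psi>_snd\<close> justifies the reading.\<close>

definition drift :: "real \<Rightarrow> real" where
  "drift t = Im (snd (\<psi> t (0, \<i>)))"

text \<open>By \<open>\<psi>_snd_eq\<close> only the second argument matters; on the imaginary axis
  the map is additive, continuous and imaginary-valued, so Cauchy's equation applies.\<close>

lemma \<psi>_snd:
  assumes t: "0 \<le> t" and u: "u \<in> domU"
  shows "snd (\<psi> t u) = of_real (drift t) * snd u"
proof -
  let ?h = "\<lambda>y. Im (snd (\<psi> t (0, \<i> * of_real y)))"
  have dom: "(0, \<i> * of_real y) \<in> domU" for y by (simp add: domU_def)
  have "?h y = ?h 1 * y" for y
  proof (rule continuous_additive_real)
    show "?h (x + y) = ?h x + ?h y" for x y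
      using \<psi>_snd_add[OF t dom dom, of x y] by (simp add: distrib_left)
    show "continuous_on UNIV ?h"
      by (intro continuous_intros continuous_on_compose2[OF continuous_on_\<psi>[OF t]]) (use dom in auto)
  qed
  moreover have "Re (snd (\<psi> t (0, \<i> * of_real y))) = 0" for y
    using \<psi>_domU[OF t dom] by (simp add: domU_def)
  ultimately have "snd (\<psi> t (0, \<i> * of_real y)) = of_real (drift t) * (\<i> * of_real y)" for y
    by (simp add: complex_eq_iff drift_def)
  moreover have "snd u = \<i> * of_real (Im (snd u))" using u by (simp add: domU_def complex_eq_iff)
  moreover have "snd (\<psi> t u) = snd (\<psi> t (0, snd u))" using \<psi>_snd_eq[OF t, of "fst u" "snd u"] u by simp
  ultimately show ?thesis by metis
qed

lemma dom_imag: "(0, \<i>) \<in> domU"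
  by (simp add: domU_def)

lemma continuous_on_drift: "continuous_on {0..} drift"
  unfolding drift_def by (intro continuous_intros continuous_on_\<psi>_time dom_imag)

lemma drift_nonzero:
  assumes "0 \<le> t"
  shows "drift t \<noteq> 0"
proof (rule nonzero_of_halving[OF continuous_on_drift _ _ assms])
  show "drift 0 \<noteq> 0" by (simp add: drift_def \<psi>_0 dom_imag)
  fix t :: real assume t: "0 \<le> t" "drift t = 0"
  \<comment> \<open>The flow property makes the drift at \<open>t\<close> the square of the drift at
    \<open>t / 2\<close>.\<close>
  have "of_real (drift (t / 2 + t / 2)) * \<i> = of_real (drift (t / 2)) * (of_real (drift (t / 2)) * \<i>)"
    using \<psi>_add[of "t / 2" "t / 2" "(0, \<i>)"] \<psi>_snd[of "t / 2 + t / 2" "(0, \<i>)"] t(1) dom_imag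
      \<psi>_snd[of "t / 2" "\<psi> (t / 2) (0, \<i>)"] \<psi>_snd[of "t / 2" "(0, \<i>)"] \<psi>_domU[of "t / 2" "(0, \<i>)"]
    by simp
  then show "drift (t / 2) = 0" using t(2) by simp
qed

section \<open>Strict negativity of the first component\<close>

text \<open>Degeneracy at any one \<open>u\<close> means that \<open>Q t (1, 0)\<close> lives where
  the first coordinate is zero, and this no longer refers to \<open>u\<close>. The fixed point (-1,
  0) can therefore serve as witness in the halving argument.\<close>

lemma \<psi>_fst_degenerate:
  assumes t: "0 \<le> t" and u: "u \<in> domU" "Re (fst u) < 0" and z: "Re (fst (\<psi> t u)) = 0"
  shows "Re (fst (\<psi> t (-1, 0))) = 0"
proof -
  let ?q = "Q t (1, 0)" and ?v = "(-1, 0) :: complex \<times> complex"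
  have x: "(1, 0) \<in> stateD" by (simp add: stateD_def)
  have q: "?q \<in> probD" by (rule Q_probD[OF t x])
  have v: "?v \<in> domU" by (simp add: domU_def)
  have "norm (transform ?q u) = 1"
    using z by (simp add: transform_Q t x u pairing_axes)
  then have "AE \<xi> in ?q. exp (pairing ?v \<xi>) = exp (pairing 0 \<xi>)"
    using AE_fst_eq_0[OF q u] by (auto elim!: eventually_mono simp: pairing_def)
  from transform_cong_AE[OF q this] have "transform ?q ?v = 1" by (simp add: transform_0 q)
  then have "norm (exp (fst (\<psi> t ?v))) = 1" by (simp add: transform_Q t x v pairing_axes)
  then show ?thesis by simp
qed

lemma \<psi>_fst_neg:
  assumes t: "0 \<le> t" and u: "u \<in> domU" "Re (fst u) < 0"
  shows "Re (fst (\<psi> t u)) < 0"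
proof -
  let ?v = "(-1, 0) :: complex \<times> complex"
  have v: "?v \<in> domU" by (simp add: domU_def)
  have "Re (fst (\<psi> t ?v)) \<noteq> 0"
  proof (rule nonzero_of_halving[OF _ _ _ t])
    show "continuous_on {0..} (\<lambda>t. Re (fst (\<psi> t ?v)))"
      by (intro continuous_intros continuous_on_\<psi>_time v)
    show "Re (fst (\<psi> 0 ?v)) \<noteq> 0" by (simp add: \<psi>_0 v)
    fix t :: real assume t: "0 \<le> t" and z: "Re (fst (\<psi> t ?v)) = 0"
    let ?w = "\<psi> (t / 2) ?v"
    have w: "?w \<in> domU" using t v by (simp add: \<psi>_domU)
    have z': "Re (fst (\<psi> (t / 2) ?w)) = 0" using \<psi>_add[of "t / 2" "t / 2" ?v] t v z by simp
    \<comment> \<open>Otherwise \<open>?w\<close> is an argument with negative real part at which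
      time \<open>t / 2\<close> degenerates; then time \<open>t / 2\<close> also degenerates at
      \<open>?v\<close>, which is the claim about \<open>?w\<close> itself.\<close>
    show "Re (fst ?w) = 0"
    proof (rule ccontr)
      assume "Re (fst ?w) \<noteq> 0"
      with w have "Re (fst ?w) < 0" by (simp add: domU_def)
      from \<psi>_fst_degenerate[OF _ w this z'] t \<open>Re (fst ?w) \<noteq> 0\<close> show False by simp
    qed
  qed
  then have "Re (fst (\<psi> t u)) \<noteq> 0" using \<psi>_fst_degenerate[OF t u] by blast
  then show ?thesis using \<psi>_domU[OF t u(1)] by (simp add: domU_def)
qed

section \<open>The transform of the skew convolution semigroup\<close>

lemma \<gamma>_probD: "0 \<le> t \<Longrightarrow> \<gamma> t \<in> probD"
  using SC by (simp add: SC_semigroup_def)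

lemma transform_\<gamma>_add:
  assumes "0 \<le> r" "0 \<le> t" "u \<in> domU"
  shows "transform (\<gamma> (r + t)) u = transform (\<gamma> r) (\<psi> t u) * transform (\<gamma> t) u"
proof -
  have "\<gamma> (r + t) = convD (\<gamma> r \<bind> Q t) (\<gamma> t)"
    using SC assms by (simp add: SC_semigroup_def)
  then show ?thesis
    using assms by (simp add: transform_convD bind_in_probD \<gamma>_probD Q_measurable transform_bind_Q)
qed

lemma convex_domU: "convex domU"
  unfolding domU_def by (rule convexI) (auto simp: mult_nonneg_nonpos add_nonpos_nonpos)

lemma zero_domU: "0 \<in> domU"
  by (simp add: domU_def)

text \<open>At r = t = 0 the transform is idempotent, hence takes values in {0, 1}; continuity on
  the connected set \<open>domU\<close> makes it constant, with value one at the origin.\<close>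

lemma transform_\<gamma>_0:
  assumes u: "u \<in> domU"
  shows "transform (\<gamma> 0) u = 1"
proof -
  have idem: "transform (\<gamma> 0) v * (transform (\<gamma> 0) v - 1) = 0" if "v \<in> domU" for v
    using transform_\<gamma>_add[of 0 0 v] that by (simp add: \<psi>_0 algebra_simps)
  have "transform (\<gamma> 0) ` domU \<subseteq> {0, 1}" using idem by auto
  then have "finite (transform (\<gamma> 0) ` domU)" by (rule finite_subset) simp
  then have "transform (\<gamma> 0) constant_on domU"
    by (intro continuous_finite_range_constant convex_connected convex_domU
        continuous_on_transform probD_subprobD \<gamma>_probD) auto
  then have "transform (\<gamma> 0) u = transform (\<gamma> 0) 0"
    using u zero_domU unfolding constant_on_def by metis
  then show ?thesis by (simp add: transform_0 \<gamma>_probD)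
qed

lemma \<gamma>_0: "\<gamma> 0 = return borelD 0"
proof (rule transform_unique)
  have "0 \<in> stateD" by (simp add: stateD_def)
  then show "return borelD 0 \<in> probD"
    and "\<And>u. u \<in> domU \<Longrightarrow> transform (\<gamma> 0) u = transform (return borelD 0) u"
    by (simp_all add: return_in_probD transform_return transform_\<gamma>_0)
qed (simp add: \<gamma>_probD)

text \<open>The argument moves with \<open>n\<close> because the proof of
  \<open>transform_\<gamma>_nonzero\<close> evaluates along the flow. Boundedness of
  \<open>v\<close> gives one test function dominating all the integrands.\<close>

lemma tendsto_transform_\<gamma>_0:
  assumes r: "\<And>n. 0 \<le> r n" "r \<longlonglongrightarrow> 0" and v: "\<And>n. v n \<in> domU" "v \<longlonglongrightarrow> w"
  shows "(\<lambda>n. transform (\<gamma> (r n)) (v n)) \<longlonglongrightarrow> 1"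
proof -
  from v(2) have "Bseq v" using convergentI convergent_imp_Bseq by blast
  then obtain C where C: "0 < C" "\<And>n. norm (v n) \<le> C" by (auto simp: Bseq_def)
  \<comment> \<open>The bound 2 holds for |exp z - 1| when |exp z| \<le> 1, and the other term
    dominates the pairing uniformly in \<open>n\<close>. The function is continuous, bounded and
    zero at the origin.\<close>
  define f where "f \<xi> = min 2 (2 * C * norm \<xi>)" for \<xi> :: "real \<times> real"
  have cont: "continuous_on stateD f" unfolding f_def by (intro continuous_intros)
  have bdd: "\<bar>f \<xi>\<bar> \<le> 2" for \<xi> using C by (simp add: f_def)
  have int: "integrable (\<gamma> (r n)) f" for n
    using bdd by (intro integrableD[OF cont, where B = 2] probD_subprobD \<gamma>_probD r) auto
  have "continuous_on {0..} (\<lambda>t. \<integral>\<xi>. f \<xi> \<partial>\<gamma> t)"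
    using wc cont bdd unfolding weakly_continuous_def by (auto intro!: boundedI[where B = 2])
  then have "(\<lambda>n. \<integral>\<xi>. f \<xi> \<partial>\<gamma> (r n)) \<longlonglongrightarrow> (\<integral>\<xi>. f \<xi> \<partial>\<gamma> 0)"
    by (rule continuous_on_tendsto_compose[where f = "\<lambda>t. \<integral>\<xi>. f \<xi> \<partial>\<gamma> t"]) (use r in auto)
  also have "(\<integral>\<xi>. f \<xi> \<partial>\<gamma> 0) = f 0"
    unfolding \<gamma>_0 by (rule integral_return)
      (auto simp: space_restrict_space stateD_def intro!: borel_measurable_continuous_on_restrict[OF cont[unfolded stateD_def]])
  finally have lim: "(\<lambda>n. \<integral>\<xi>. f \<xi> \<partial>\<gamma> (r n)) \<longlonglongrightarrow> 0" by (simp add: f_def)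
  have "norm (transform (\<gamma> (r n)) (v n) - 1) \<le> (\<integral>\<xi>. f \<xi> \<partial>\<gamma> (r n))" for n
  proof -
    have p: "\<gamma> (r n) \<in> probD" by (rule \<gamma>_probD[OF r(1)])
    interpret prob_space "\<gamma> (r n)" by (rule probDD(1)[OF p])
    let ?e = "\<lambda>\<xi>. exp (pairing (v n) \<xi>)"
    have ie: "integrable (\<gamma> (r n)) ?e" by (rule integrable_exp_pairing[OF v(1) probD_subprobD[OF p]])
    have "norm (transform (\<gamma> (r n)) (v n) - 1) = norm (\<integral>\<xi>. ?e \<xi> - 1 \<partial>\<gamma> (r n))"
      using ie by (simp add: transform_def prob_space)
    also have "\<dots> \<le> (\<integral>\<xi>. norm (?e \<xi> - 1) \<partial>\<gamma> (r n))" by (rule integral_norm_bound)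
    also have "\<dots> \<le> (\<integral>\<xi>. f \<xi> \<partial>\<gamma> (r n))"
    proof (rule integral_mono)
      fix \<xi> assume "\<xi> \<in> space (\<gamma> (r n))"
      then have \<xi>: "\<xi> \<in> stateD" using probDD(3)[OF p] by simp
      have n1: "norm (?e \<xi>) \<le> 1" by (rule norm_exp_pairing_le[OF v(1) \<xi>])
      then have "norm (?e \<xi> - 1) \<le> norm (pairing (v n) \<xi>)"
        by (intro norm_exp_minus_1_le) simp
      also have "\<dots> \<le> 2 * norm (v n) * norm \<xi>" by (rule norm_pairing_le)
      also have "\<dots> \<le> 2 * C * norm \<xi>" using C by (intro mult_right_mono) auto
      finally show "norm (?e \<xi> - 1) \<le> f \<xi>"
        using order_trans[OF norm_triangle_ineq4[of "?e \<xi>" 1] add_right_mono[OF n1]] by (simp add: f_def)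
    qed (use ie int in auto)
    finally show ?thesis .
  qed
  then have "(\<lambda>n. transform (\<gamma> (r n)) (v n) - 1) \<longlonglongrightarrow> 0"
    by (intro Lim_null_comparison[OF always_eventually lim]) auto
  then show ?thesis by (simp add: LIM_zero_iff)
qed

lemma continuous_on_transform_\<gamma>: "u \<in> domU \<Longrightarrow> continuous_on {0..} (\<lambda>t. transform (\<gamma> t) u)"
  by (rule continuous_on_transform_time[OF wc \<gamma>_probD])

lemma transform_\<gamma>_nonzero:
  assumes t: "0 \<le> t" and u: "u \<in> domU"
  shows "transform (\<gamma> t) u \<noteq> 0"
proof
  assume "transform (\<gamma> t) u = 0"
  define Z where "Z = {t \<in> {0..}. transform (\<gamma> t) u = 0}"
  have ne: "Z \<noteq> {}" using t \<open>transform (\<gamma> t) u = 0\<close> by (auto simp: Z_def)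
  have bb: "bdd_below Z" by (rule bdd_belowI[where m = 0]) (auto simp: Z_def)
  have "closed Z"
    unfolding Z_def by (intro continuous_closed_preimage_constant continuous_on_transform_\<gamma> u closed_atLeast)
  then have "Inf Z \<in> Z" by (rule closed_contains_Inf[OF ne bb])
  define t0 where "t0 = Inf Z"
  have t0: "0 \<le> t0" "transform (\<gamma> t0) u = 0" using \<open>Inf Z \<in> Z\<close> by (auto simp: t0_def Z_def)
  then have "0 < t0" using transform_\<gamma>_0[OF u] by (cases "t0 = 0") auto
  have least: "transform (\<gamma> s) u \<noteq> 0" if "0 \<le> s" "s < t0" for s
    using cInf_lower[OF _ bb, of s] that by (auto simp: t0_def Z_def)
  define r where "r n = t0 / real (Suc n)" for n
  have r: "0 < r n" "r n \<le> t0" for n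
    using \<open>0 < t0\<close> by (auto simp: r_def pos_divide_le_eq)
  have r0: "r \<longlonglongrightarrow> 0" unfolding r_def by (rule LIMSEQ_Suc[OF lim_const_over_n])
  \<comment> \<open>Since \<open>r n\<close> is positive, \<open>t0 - r n\<close> lies strictly
    before the first zero. The second factor of the product is thus nonzero, and the first must
    vanish.\<close>
  have zero: "transform (\<gamma> (r n)) (\<psi> (t0 - r n) u) = 0" for n
    using transform_\<gamma>_add[of "r n" "t0 - r n" u] r[of n] u t0(2) least[of "t0 - r n"] by simp
  have "(\<lambda>n. \<psi> (t0 - r n) u) \<longlonglongrightarrow> \<psi> (t0 - 0) u"
  proof -
    have "(\<lambda>n. t0 - r n) \<longlonglongrightarrow> t0 - 0" by (intro tendsto_intros r0)
    then show ?thesis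
      by (rule continuous_on_tendsto_compose[OF continuous_on_\<psi>_time[OF u]]) (use r t0(1) in auto)
  qed
  from tendsto_transform_\<gamma>_0[OF _ r0 _ this] have "(\<lambda>n. 0 :: complex) \<longlonglongrightarrow> 1"
    using r u zero by (simp add: less_imp_le \<psi>_domU)
  then show False by (simp add: LIMSEQ_const_iff)
qed

end

section \<open>The affine semigroup\<close>

lemma tendsto_C0D_at_infinity:
  fixes y :: "nat \<Rightarrow> real \<times> real"
  assumes f: "f \<in> C0D" and y: "\<And>n. y n \<in> stateD" "filterlim (\<lambda>n. norm (y n)) at_top sequentially"
  shows "(\<lambda>n. f (y n)) \<longlonglongrightarrow> 0"
  unfolding tendsto_iff
proof (intro allI impI)
  fix e :: real assume "0 < e"
  then obtain R where R: "\<And>x. x \<in> stateD \<Longrightarrow> R \<le> norm x \<Longrightarrow> \<bar>f x\<bar> < e"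
    using f unfolding C0D_iff by meson
  have "\<forall>\<^sub>F n in sequentially. R \<le> norm (y n)"
    using y(2) by (simp add: filterlim_at_top)
  then show "\<forall>\<^sub>F n in sequentially. dist (f (y n)) 0 < e"
    by eventually_elim (use R y(1) in simp)
qed

text \<open>Compactness of the extended reals makes the norms converge along a subsequence; a finite
  limit gives boundedness, and Bolzano-Weierstrass applies.\<close>

lemma subseq_tendsto_or_at_infinity:
  fixes x :: "nat \<Rightarrow> real \<times> real"
  obtains l r where "strict_mono (r :: nat \<Rightarrow> nat)" "(\<lambda>n. x (r n)) \<longlonglongrightarrow> l"
  | r where "strict_mono (r :: nat \<Rightarrow> nat)" "filterlim (\<lambda>n. norm (x (r n))) at_top sequentially"
proof -
  obtain l r where r: "strict_mono (r :: nat \<Rightarrow> nat)" "((\<lambda>n. ereal (norm (x n))) \<circ> r) \<longlonglongrightarrow> l"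
    using compact_complete_linorder by blast
  then have lim: "(\<lambda>n. ereal (norm (x (r n)))) \<longlonglongrightarrow> l" by (simp add: comp_def)
  show ?thesis
  proof (cases l)
    case PInf
    then show ?thesis using that(2)[OF r(1)] lim by (simp add: tendsto_PInfty_eq_at_top)
  next
    case MInf
    have "0 \<le> l" by (rule tendsto_lowerbound[OF lim]) auto
    with MInf show ?thesis by simp
  next
    case (real a)
    with lim have "(\<lambda>n. norm (x (r n))) \<longlonglongrightarrow> a" by simp
    then have "Bseq (\<lambda>n. norm (x (r n)))" using convergentI convergent_imp_Bseq by blast
    then obtain K where "\<And>n. norm (x (r n)) \<le> K" by (auto simp: Bseq_def)
    then have "bounded (range (x \<circ> r))" by (auto intro: boundedI)
    then obtain b r' where "strict_mono (r' :: nat \<Rightarrow> nat)" "((x \<circ> r) \<circ> r') \<longlonglongrightarrow> b"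
      using bounded_imp_convergent_subsequence by blast
    then show ?thesis using that(1)[OF strict_mono_o[OF r(1)], of r' b] by (simp add: comp_def)
  qed
qed

lemma transform_null_measure: "transform (null_measure borelD) u = 0"
  by (simp add: transform_def)

context affine_setting
begin

section \<open>Semigroup property and affine exponent\<close>

lemma P_probD: "0 \<le> t \<Longrightarrow> x \<in> stateD \<Longrightarrow> P t x \<in> probD"
  by (simp add: P_eq convD_in_probD Q_probD \<gamma>_probD)

lemma transform_P:
  "0 \<le> t \<Longrightarrow> x \<in> stateD \<Longrightarrow> u \<in> domU \<Longrightarrow>
    transform (P t x) u = exp (pairing (\<psi> t u) x) * transform (\<gamma> t) u"
  by (simp add: P_eq transform_convD Q_probD \<gamma>_probD transform_Q)

lemma P_measurable:
  assumes t: "0 \<le> t"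
  shows "P t \<in> borelD \<rightarrow>\<^sub>M prob_algebra borelD"
proof -
  have "(\<lambda>x. distr (Q t x \<Otimes>\<^sub>M \<gamma> t) borelD (\<lambda>(x, y). x + y)) \<in> borelD \<rightarrow>\<^sub>M prob_algebra borelD"
    by (rule measurable_compose[OF measurable_pair_prob[OF Q_measurable[OF t] measurable_const[OF \<gamma>_probD[OF t]]]
        measurable_distr_prob_space[OF measurable_plus_borelD]])
  then show ?thesis
    by (rule measurable_cong[THEN iffD1, rotated])
       (simp add: space_restrict_space P_eq convD_eq_distr t Q_probD \<gamma>_probD)
qed

lemma P_0:
  assumes x: "x \<in> stateD"
  shows "P 0 x = return borelD x"
  by (rule transform_unique)
     (simp_all add: x P_probD return_in_probD transform_P transform_return \<psi>_0 transform_\<gamma>_0)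

lemma P_add:
  assumes r: "0 \<le> r" and t: "0 \<le> t" and x: "x \<in> stateD"
  shows "P (r + t) x = P r x \<bind> P t"
proof (rule transform_unique)
  show "P (r + t) x \<in> probD" using assms by (simp add: P_probD)
  show "P r x \<bind> P t \<in> probD" using assms by (intro bind_in_probD P_probD P_measurable)
  fix u assume u: "u \<in> domU"
  have "transform (P r x \<bind> P t) u = (\<integral>y. transform (P t y) u \<partial>P r x)"
    by (rule transform_bind[OF P_probD[OF r x] P_measurable[OF t] u])
  also have "\<dots> = (\<integral>y. exp (pairing (\<psi> t u) y) * transform (\<gamma> t) u \<partial>P r x)"
    by (intro Bochner_Integration.integral_cong refl transform_P t u)
       (use probDD(3)[OF P_probD[OF r x]] in auto)
  also have "\<dots> = transform (P r x) (\<psi> t u) * transform (\<gamma> t) u"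
    unfolding transform_def[of "P r x"] by (rule integral_mult_left_zero)
  also have "\<dots> = transform (P (r + t) x) u"
    using r t x u by (simp add: transform_P \<psi>_domU \<psi>_add transform_\<gamma>_add)
  finally show "transform (P (r + t) x) u = transform (P r x \<bind> P t) u" by simp
qed

lemma log_transform_\<gamma>:
  assumes t: "0 \<le> t"
  shows "\<exists>\<phi>. continuous_on domU \<phi> \<and> \<phi> 0 = 0 \<and> (\<forall>u\<in>domU. transform (\<gamma> t) u = exp (\<phi> u))"
proof -
  obtain g where g: "continuous_on domU g" "\<And>u. u \<in> domU \<Longrightarrow> transform (\<gamma> t) u = exp (g u)"
    using continuous_logarithm_on_contractible[OF
        continuous_on_transform[OF probD_subprobD[OF \<gamma>_probD[OF t]]]
        convex_imp_contractible[OF convex_domU] transform_\<gamma>_nonzero[OF t]] by blast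
  \<comment> \<open>The logarithm at the origin is a multiple of 2 pi i, so subtracting it
    normalises the exponent without changing its exponential.\<close>
  have "exp (g 0) = 1" using g(2)[OF zero_domU] by (simp add: transform_0 \<gamma>_probD t)
  then have "transform (\<gamma> t) u = exp (g u - g 0)" if "u \<in> domU" for u
    using g(2)[OF that] by (simp add: exp_diff)
  then show ?thesis using g(1) by (intro exI[of _ "\<lambda>u. g u - g 0"]) (auto intro!: continuous_intros)
qed

lemma affine: "affine_semigroup Q \<psi> P"
proof -
  obtain \<phi> where \<phi>: "\<And>t. 0 \<le> t \<Longrightarrow> continuous_on domU (\<phi> t) \<and> \<phi> t 0 = 0 \<and>
      (\<forall>u\<in>domU. transform (\<gamma> t) u = exp (\<phi> t u))"
    using log_transform_\<gamma> by metis
  have "(\<integral>\<xi>. exp (pairing u \<xi>) \<partial>P t x) = exp (pairing (\<psi> t u) x + \<phi> t u)"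
    if "0 \<le> t" "x \<in> stateD" "u \<in> domU" for t x u
    using transform_P[OF that] \<phi>[OF that(1)] that(3) by (simp add: transform_def exp_add)
  then show ?thesis
    unfolding affine_semigroup_def transition_semigroup_def
    using HA P_measurable P_0 P_add \<phi> by blast
qed

section \<open>Limits along sequences of times and starting points\<close>

text \<open>Both arguments move: constant times give continuity of the image function, and times
  tending to zero give strong continuity.\<close>

lemma tendsto_P:
  assumes t: "\<And>n. 0 \<le> t n" "t \<longlonglongrightarrow> t'" "0 \<le> t'"
    and x: "\<And>n. x n \<in> stateD" "x \<longlonglongrightarrow> x'" "x' \<in> stateD" and f: "f \<in> C0D"
  shows "(\<lambda>n. \<integral>\<xi>. f \<xi> \<partial>P (t n) (x n)) \<longlonglongrightarrow> (\<integral>\<xi>. f \<xi> \<partial>P t' x')"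
proof -
  have "(\<lambda>n. (\<integral>\<xi>. f \<xi> \<partial>P (t n) (x n)) - (\<integral>\<xi>. f \<xi> \<partial>P t' x')) \<longlonglongrightarrow> 0"
  proof (rule tendsto_integral_diff_transform[OF probD_subprobD[OF P_probD[OF t(1) x(1)]]
      probD_subprobD[OF P_probD[OF t(3) x(3)]] _ f])
    fix u assume u: "u \<in> domU"
    have "(\<lambda>n. \<psi> (t n) u) \<longlonglongrightarrow> \<psi> t' u"
      by (rule continuous_on_tendsto_compose[OF continuous_on_\<psi>_time[OF u] t(2)]) (use t in auto)
    moreover have "(\<lambda>n. transform (\<gamma> (t n)) u) \<longlonglongrightarrow> transform (\<gamma> t') u"
      by (rule continuous_on_tendsto_compose[OF continuous_on_transform_\<gamma>[OF u] t(2)]) (use t in auto)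
    ultimately have "(\<lambda>n. exp (pairing (\<psi> (t n) u) (x n)) * transform (\<gamma> (t n)) u)
        \<longlonglongrightarrow> exp (pairing (\<psi> t' u) x') * transform (\<gamma> t') u"
      using x(2) by (intro tendsto_intros)
    then show "(\<lambda>n. transform (P (t n) (x n)) u - transform (P t' x') u) \<longlonglongrightarrow> 0"
      unfolding transform_P[OF t(1) x(1) u] transform_P[OF t(3) x(3) u] by (simp add: LIM_zero_iff)
  qed
  then show ?thesis by (simp add: LIM_zero_iff)
qed

lemma P_escape_fst:
  assumes t: "\<And>n. 0 \<le> t n" "t \<longlonglongrightarrow> t'" "0 \<le> t'"
    and x: "\<And>n. x n \<in> stateD" "filterlim (\<lambda>n. fst (x n)) at_top sequentially" and f: "f \<in> C0D"
  shows "(\<lambda>n. \<integral>\<xi>. f \<xi> \<partial>P (t n) (x n)) \<longlonglongrightarrow> 0"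
proof -
  \<comment> \<open>Total loss of mass is expressed as comparison with the zero measure, whose
    transform is zero.\<close>
  have "null_measure borelD \<in> subprobD"
    by (simp add: null_measure_in_space_subprob_algebra space_restrict_space stateD_def) fastforce
  have "(\<lambda>n. (\<integral>\<xi>. f \<xi> \<partial>P (t n) (x n)) - (\<integral>\<xi>. f \<xi> \<partial>null_measure borelD)) \<longlonglongrightarrow> 0"
  proof (rule tendsto_integral_diff_transform[OF probD_subprobD[OF P_probD[OF t(1) x(1)]]
      \<open>null_measure borelD \<in> subprobD\<close> _ f])
    fix u assume u: "u \<in> domU" "Re (fst u) < 0"
    have "(\<lambda>n. \<psi> (t n) u) \<longlonglongrightarrow> \<psi> t' u"
      by (rule continuous_on_tendsto_compose[OF continuous_on_\<psi>_time[OF u(1)] t(2)]) (use t in auto)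
    then have "(\<lambda>n. Re (fst (\<psi> (t n) u))) \<longlonglongrightarrow> Re (fst (\<psi> t' u))" by (intro tendsto_intros)
    then have "filterlim (\<lambda>n. Re (fst (\<psi> (t n) u)) * fst (x n)) at_bot sequentially"
      by (rule filterlim_tendsto_neg_mult_at_bot[OF _ \<psi>_fst_neg[OF t(3) u] x(2)])
    then have lim: "(\<lambda>n. exp (Re (fst (\<psi> (t n) u)) * fst (x n))) \<longlonglongrightarrow> 0"
      by (rule filterlim_compose[OF exp_at_bot])
    have "norm (transform (P (t n) (x n)) u) \<le> exp (Re (fst (\<psi> (t n) u)) * fst (x n))" for n
    proof -
      have "norm (transform (P (t n) (x n)) u)
          = exp (Re (fst (\<psi> (t n) u)) * fst (x n)) * norm (transform (\<gamma> (t n)) u)"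
        using t(1) x(1) u(1) by (simp add: transform_P norm_mult Re_pairing \<psi>_domU)
      also have "\<dots> \<le> exp (Re (fst (\<psi> (t n) u)) * fst (x n)) * 1"
        by (intro mult_left_mono norm_transform_le u probD_subprobD \<gamma>_probD t) simp
      finally show ?thesis by simp
    qed
    then have "(\<lambda>n. transform (P (t n) (x n)) u) \<longlonglongrightarrow> 0"
      by (intro Lim_null_comparison[OF always_eventually lim]) auto
    then show "(\<lambda>n. transform (P (t n) (x n)) u - transform (null_measure borelD) u) \<longlonglongrightarrow> 0"
      by (simp add: transform_null_measure)
  qed
  then show ?thesis by simp
qed

text \<open>Up to a vanishing error, \<open>P (t n) (x n)\<close> is a fixed measure translated by
  \<open>drift (t n) * snd (x n)\<close> in the second coordinate.\<close>

lemma P_escape_snd: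
  assumes t: "\<And>n. 0 \<le> t n" "t \<longlonglongrightarrow> t'" "0 \<le> t'"
    and x: "\<And>n. x n \<in> stateD" "(\<lambda>n. fst (x n)) \<longlonglongrightarrow> a"
      "filterlim (\<lambda>n. \<bar>snd (x n)\<bar>) at_top sequentially" and f: "f \<in> C0D"
  shows "(\<lambda>n. \<integral>\<xi>. f \<xi> \<partial>P (t n) (x n)) \<longlonglongrightarrow> 0"
proof -
  have "0 \<le> a" by (rule tendsto_lowerbound[OF x(2)]) (use x(1) in \<open>auto simp: stateD_def\<close>)
  then have a: "(a, 0) \<in> stateD" by (simp add: stateD_def)
  \<comment> \<open>The limit law with the divergent second coordinate removed; only translates of
    it are needed.\<close>
  define \<rho> where "\<rho> = P t' (a, 0)"
  have \<rho>: "\<rho> \<in> probD" unfolding \<rho>_def by (rule P_probD[OF t(3) a])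
  interpret prob_space \<rho> by (rule probDD(1)[OF \<rho>])
  define d where "d n = drift (t n) * snd (x n)" for n
  define \<sigma> where "\<sigma> n = distr \<rho> borelD (\<lambda>\<xi>. \<xi> + (0, d n))" for n
  have shift: "\<xi> \<in> stateD \<Longrightarrow> \<xi> + (0, d n) \<in> stateD" for \<xi> n by (simp add: stateD_def)
  have meas: "(\<lambda>\<xi>. \<xi> + (0, d n)) \<in> \<rho> \<rightarrow>\<^sub>M borelD" for n
    by (intro measurable_restrict_space2 measurableD_continuous[OF _ probD_subprobD[OF \<rho>]] continuous_intros)
       (use shift probDD(3)[OF \<rho>] in auto)
  have \<sigma>: "\<sigma> n \<in> probD" for n
    by (simp add: \<sigma>_def space_prob_algebra prob_space_distr[OF meas])
  have transform_\<sigma>: "transform (\<sigma> n) u = exp (snd u * of_real (d n)) * transform \<rho> u" for n u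
  proof -
    have "transform (\<sigma> n) u = (\<integral>\<xi>. exp (pairing u (\<xi> + (0, d n))) \<partial>\<rho>)"
      unfolding transform_def \<sigma>_def
      by (rule integral_distr[OF meas]) (intro borel_measurable_continuous_on_restrict continuous_intros)
    also have "\<dots> = (\<integral>\<xi>. exp (snd u * of_real (d n)) * exp (pairing u \<xi>) \<partial>\<rho>)"
      by (simp add: pairing_add_right exp_add pairing_axes mult.commute)
    finally show ?thesis by (simp add: transform_def)
  qed
  have "(\<lambda>n. (\<integral>\<xi>. f \<xi> \<partial>P (t n) (x n)) - (\<integral>\<xi>. f \<xi> \<partial>\<sigma> n)) \<longlonglongrightarrow> 0"
  proof (rule tendsto_integral_diff_transform[OF probD_subprobD[OF P_probD[OF t(1) x(1)]]
      probD_subprobD[OF \<sigma>] _ f])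
    fix u assume u: "u \<in> domU"
    \<comment> \<open>\<open>c n\<close> collects the factors that converge. What remains of the
      transform of \<open>P (t n) (x n)\<close> is a factor of modulus one, shared with \<sigma> and
      cancelled by taking norms of differences.\<close>
    define c where "c n = exp (fst (\<psi> (t n) u) * of_real (fst (x n))) * transform (\<gamma> (t n)) u" for n
    define c' where "c' = exp (fst (\<psi> t' u) * of_real a) * transform (\<gamma> t') u"
    have "(\<lambda>n. \<psi> (t n) u) \<longlonglongrightarrow> \<psi> t' u"
      by (rule continuous_on_tendsto_compose[OF continuous_on_\<psi>_time[OF u] t(2)]) (use t in auto)
    moreover have "(\<lambda>n. transform (\<gamma> (t n)) u) \<longlonglongrightarrow> transform (\<gamma> t') u"
      by (rule continuous_on_tendsto_compose[OF continuous_on_transform_\<gamma>[OF u] t(2)]) (use t in auto)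
    ultimately have "c \<longlonglongrightarrow> c'"
      unfolding c_def c'_def using x(2) by (intro tendsto_intros)
    then have lim: "(\<lambda>n. norm (c n - c')) \<longlonglongrightarrow> 0" by (simp add: LIM_zero tendsto_norm_zero)
    have P: "transform (P (t n) (x n)) u = exp (snd u * of_real (d n)) * c n" for n
      by (simp add: transform_P[OF t(1) x(1) u] pairing_def \<psi>_snd[OF t(1) u] exp_add c_def d_def mult_ac)
    have \<rho>': "transform \<rho> u = c'"
      unfolding \<rho>_def transform_P[OF t(3) a u] c'_def by (simp add: pairing_axes)
    have "norm (transform (P (t n) (x n)) u - transform (\<sigma> n) u) = norm (c n - c')" for n
    proof -
      have "transform (P (t n) (x n)) u - transform (\<sigma> n) u = exp (snd u * of_real (d n)) * (c n - c')"
        unfolding P transform_\<sigma> \<rho>' by (simp add: right_diff_distrib)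
      moreover have "norm (exp (snd u * of_real (d n))) = 1" using u by (simp add: domU_def)
      ultimately show ?thesis by (simp only: norm_mult mult_1)
    qed
    with lim have "(\<lambda>n. norm (transform (P (t n) (x n)) u - transform (\<sigma> n) u)) \<longlonglongrightarrow> 0" by simp
    then show "(\<lambda>n. transform (P (t n) (x n)) u - transform (\<sigma> n) u) \<longlonglongrightarrow> 0"
      by (rule tendsto_norm_zero_cancel)
  qed
  moreover have "(\<lambda>n. \<integral>\<xi>. f \<xi> \<partial>\<sigma> n) \<longlonglongrightarrow> 0"
  proof -
    obtain B where B: "\<And>x. x \<in> stateD \<Longrightarrow> \<bar>f x\<bar> \<le> B" using C0D_bounded[OF f] by metis
    have fm: "f \<in> borel_measurable borelD"
      using f by (intro borel_measurable_continuous_on_restrict) (simp add: C0D_def)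
    \<comment> \<open>The limit of the drifts is nonzero, so the translations \<open>d n\<close>
      diverge together with the second coordinates.\<close>
    have "(\<lambda>n. drift (t n)) \<longlonglongrightarrow> drift t'"
      by (rule continuous_on_tendsto_compose[OF continuous_on_drift t(2)]) (use t in auto)
    then have "(\<lambda>n. \<bar>drift (t n)\<bar>) \<longlonglongrightarrow> \<bar>drift t'\<bar>" by (rule tendsto_rabs)
    then have "filterlim (\<lambda>n. \<bar>drift (t n)\<bar> * \<bar>snd (x n)\<bar>) at_top sequentially"
      by (rule filterlim_tendsto_pos_mult_at_top[OF _ _ x(3)]) (use drift_nonzero[OF t(3)] in simp)
    then have d: "filterlim (\<lambda>n. \<bar>d n\<bar>) at_top sequentially" by (simp add: d_def abs_mult)
    have "(\<lambda>n. \<integral>\<xi>. f (\<xi> + (0, d n)) \<partial>\<rho>) \<longlonglongrightarrow> (\<integral>\<xi>. 0 \<partial>\<rho>)"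
    proof (rule integral_dominated_convergence[where w = "\<lambda>_. B"])
      show "(\<lambda>\<xi>. f (\<xi> + (0, d n))) \<in> borel_measurable \<rho>" for n
        by (rule measurable_compose[OF meas fm])
      show "AE \<xi> in \<rho>. norm (f (\<xi> + (0, d n))) \<le> B" for n
        using B shift probDD(3)[OF \<rho>] by (intro AE_I2) auto
      show "AE \<xi> in \<rho>. (\<lambda>n. f (\<xi> + (0, d n))) \<longlonglongrightarrow> 0"
      proof (rule AE_I2)
        fix \<xi> assume "\<xi> \<in> space \<rho>"
        then have \<xi>: "\<xi> \<in> stateD" using probDD(3)[OF \<rho>] by simp
        have "filterlim (\<lambda>n. - norm \<xi> + \<bar>d n\<bar>) at_top sequentially"
          by (rule filterlim_tendsto_add_at_top[OF tendsto_const d])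
        then have "filterlim (\<lambda>n. norm (\<xi> + (0, d n))) at_top sequentially"
        proof (rule filterlim_at_top_mono, intro always_eventually allI)
          fix n
          have "norm ((0, d n) :: real \<times> real) \<le> norm (\<xi> + (0, d n)) + norm \<xi>"
            using norm_triangle_ineq4[of "\<xi> + (0, d n)" \<xi>] by simp
          then show "- norm \<xi> + \<bar>d n\<bar> \<le> norm (\<xi> + (0, d n))" by (simp add: norm_Pair)
        qed
        then show "(\<lambda>n. f (\<xi> + (0, d n))) \<longlonglongrightarrow> 0"
          by (intro tendsto_C0D_at_infinity f shift \<xi>)
      qed
    qed simp_all
    then show ?thesis unfolding \<sigma>_def integral_distr[OF meas fm] by simp
  qed
  ultimately have "(\<lambda>n. (\<integral>\<xi>. f \<xi> \<partial>P (t n) (x n)) - (\<integral>\<xi>. f \<xi> \<partial>\<sigma> n) + (\<integral>\<xi>. f \<xi> \<partial>\<sigma> n)) \<longlonglongrightarrow> 0 + 0"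
    by (rule tendsto_add)
  then show ?thesis by simp
qed

text \<open>Only a subsequence is claimed, because the two mechanisms of escape may alternate along
  the sequence. Arguments by contradiction need no more.\<close>

lemma P_escape:
  assumes t: "\<And>n. 0 \<le> t n" "t \<longlonglongrightarrow> t'" "0 \<le> t'"
    and x: "\<And>n. x n \<in> stateD" "filterlim (\<lambda>n. norm (x n)) at_top sequentially" and f: "f \<in> C0D"
  obtains r where "strict_mono (r :: nat \<Rightarrow> nat)"
    "(\<lambda>n. \<integral>\<xi>. f \<xi> \<partial>P (t (r n)) (x (r n))) \<longlonglongrightarrow> 0"
proof -
  obtain l r where r: "strict_mono (r :: nat \<Rightarrow> nat)" "((\<lambda>n. ereal (fst (x n))) \<circ> r) \<longlonglongrightarrow> l"
    using compact_complete_linorder by blast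
  then have lim: "(\<lambda>n. ereal (fst (x (r n)))) \<longlonglongrightarrow> l" by (simp add: comp_def)
  have tr: "(\<lambda>n. t (r n)) \<longlonglongrightarrow> t'" using LIMSEQ_subseq_LIMSEQ[OF t(2) r(1)] by (simp add: comp_def)
  have xr: "filterlim (\<lambda>n. norm (x (r n))) at_top sequentially"
    by (rule filterlim_compose[OF x(2) filterlim_subseq[OF r(1)]])
  show ?thesis
  proof (cases l)
    case PInf
    then have "filterlim (\<lambda>n. fst (x (r n))) at_top sequentially"
      using lim by (simp add: tendsto_PInfty_eq_at_top)
    then show ?thesis by (intro that[OF r(1)] P_escape_fst[OF t(1) tr t(3) x(1) _ f])
  next
    case MInf
    have "0 \<le> l" by (rule tendsto_lowerbound[OF lim]) (use x(1) in \<open>auto simp: stateD_def\<close>)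
    with MInf show ?thesis by simp
  next
    case (real a)
    with lim have a: "(\<lambda>n. fst (x (r n))) \<longlonglongrightarrow> a" by simp
    have "filterlim (\<lambda>n. - \<bar>fst (x (r n))\<bar> + norm (x (r n))) at_top sequentially"
      by (rule filterlim_tendsto_add_at_top[OF tendsto_minus[OF tendsto_rabs[OF a]] xr])
    then have "filterlim (\<lambda>n. \<bar>snd (x (r n))\<bar>) at_top sequentially"
    proof (rule filterlim_at_top_mono, intro always_eventually allI)
      fix n
      show "- \<bar>fst (x (r n))\<bar> + norm (x (r n)) \<le> \<bar>snd (x (r n))\<bar>"
        using norm_Pair_le[of "fst (x (r n))" "snd (x (r n))"] by simp
    qed
    then show ?thesis by (intro that[OF r(1)] P_escape_snd[OF t(1) tr t(3) x(1) a _ f])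
  qed
qed

section \<open>The Feller property\<close>

lemma P_C0D:
  assumes f: "f \<in> C0D" and t: "0 \<le> t"
  shows "(\<lambda>x. \<integral>\<xi>. f \<xi> \<partial>P t x) \<in> C0D"
  unfolding C0D_iff
proof (intro conjI allI impI)
  show "continuous_on stateD (\<lambda>x. \<integral>\<xi>. f \<xi> \<partial>P t x)"
    unfolding continuous_on_sequentially comp_def
  proof (intro allI ballI impI)
    fix x l assume "l \<in> stateD" "(\<forall>n. x n \<in> stateD) \<and> x \<longlonglongrightarrow> l"
    then show "(\<lambda>n. \<integral>\<xi>. f \<xi> \<partial>P t (x n)) \<longlonglongrightarrow> (\<integral>\<xi>. f \<xi> \<partial>P t l)"
      by (intro tendsto_P[OF t tendsto_const t _ _ _ f]) simp_all
  qed
next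
  fix e :: real assume e: "0 < e"
  show "\<exists>R. \<forall>x\<in>stateD. R \<le> norm x \<longrightarrow> \<bar>\<integral>\<xi>. f \<xi> \<partial>P t x\<bar> < e"
  proof (rule ccontr)
    assume "\<not> ?thesis"
    then have "\<forall>n :: nat. \<exists>x\<in>stateD. real n \<le> norm x \<and> e \<le> \<bar>\<integral>\<xi>. f \<xi> \<partial>P t x\<bar>"
      by (meson not_less)
    then obtain x where x: "\<And>n. x n \<in> stateD" "\<And>n. real n \<le> norm (x n)"
      "\<And>n. e \<le> \<bar>\<integral>\<xi>. f \<xi> \<partial>P t (x n)\<bar>" by metis
    have "filterlim (\<lambda>n. norm (x n)) at_top sequentially"
      by (rule filterlim_at_top_mono[OF filterlim_real_sequentially]) (use x(2) in auto)
    from P_escape[OF t tendsto_const t x(1) this f] obtain r :: "nat \<Rightarrow> nat"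
      where "strict_mono r" "(\<lambda>n. \<integral>\<xi>. f \<xi> \<partial>P t (x (r n))) \<longlonglongrightarrow> 0" .
    from LIMSEQ_D[OF this(2) e] obtain n where "\<bar>\<integral>\<xi>. f \<xi> \<partial>P t (x (r n))\<bar> < e" by auto
    with x(3)[of "r n"] show False by simp
  qed
qed

text \<open>A failure of uniform convergence yields times tending to zero and points at which the
  gap stays above \<open>e\<close>. Along a subsequence the points converge, where joint continuity
  closes the gap, or escape, where both terms tend to zero.\<close>

lemma P_uniform_limit:
  assumes f: "f \<in> C0D"
  shows "uniform_limit stateD (\<lambda>t x. \<integral>\<xi>. f \<xi> \<partial>P t x) f (at_right 0)"
  unfolding uniform_limit_iff
proof (intro allI impI)
  fix e :: real assume e: "0 < e"
  let ?F = "\<lambda>t x. \<integral>\<xi>. f \<xi> \<partial>P t x"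
  show "\<forall>\<^sub>F t in at_right 0. \<forall>x\<in>stateD. dist (?F t x) (f x) < e"
  proof (rule ccontr)
    assume "\<not> ?thesis"
    then have "\<forall>b>0. \<exists>t. 0 < t \<and> t < b \<and> (\<exists>x\<in>stateD. e \<le> dist (?F t x) (f x))"
      by (simp add: eventually_at_right[OF zero_less_one] not_less) (meson not_less)
    then have "\<forall>n :: nat. \<exists>t x. 0 < t \<and> t < 1 / Suc n \<and> x \<in> stateD \<and> e \<le> dist (?F t x) (f x)"
      by (metis of_nat_0_less_iff zero_less_Suc zero_less_divide_1_iff)
    then obtain t x where tx: "\<And>n. 0 < t n" "\<And>n. t n < 1 / Suc n" "\<And>n. x n \<in> stateD"
      "\<And>n. e \<le> dist (?F (t n) (x n)) (f (x n))" by metis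
    have t0: "t \<longlonglongrightarrow> 0"
      by (rule tendsto_sandwich[OF _ _ tendsto_const LIMSEQ_Suc[OF lim_1_over_n]])
         (use tx(1,2) in \<open>auto intro!: always_eventually less_imp_le\<close>)
    have no: False if "strict_mono r" "(\<lambda>n. ?F (t (r n)) (x (r n)) - f (x (r n))) \<longlonglongrightarrow> 0"
      for r :: "nat \<Rightarrow> nat"
    proof -
      from LIMSEQ_D[OF that(2) e] obtain n where
        "norm (?F (t (r n)) (x (r n)) - f (x (r n)) - 0) < e" by blast
      with tx(4)[of "r n"] show False by (simp add: dist_real_def)
    qed
    show False
    proof (cases x rule: subseq_tendsto_or_at_infinity)
      case (1 l r)
      have l: "l \<in> stateD" using closed_sequentially[OF closed_stateD _ 1(2)] tx(3) by blast
      have "(\<lambda>n. ?F (t (r n)) (x (r n))) \<longlonglongrightarrow> ?F 0 l"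
        using LIMSEQ_subseq_LIMSEQ[OF t0 1(1)] tx(1)
        by (intro tendsto_P[OF _ _ _ tx(3) 1(2) l f]) (auto simp: comp_def less_imp_le)
      moreover have "?F 0 l = f l"
        unfolding P_0[OF l]
        by (rule integral_return)
           (use l f in \<open>auto simp: space_restrict_space C0D_def intro!: borel_measurable_continuous_on_restrict\<close>)
      moreover have "(\<lambda>n. f (x (r n))) \<longlonglongrightarrow> f l"
        by (rule continuous_on_tendsto_compose[OF _ 1(2) l]) (use f tx(3) in \<open>auto simp: C0D_def\<close>)
      ultimately have "(\<lambda>n. ?F (t (r n)) (x (r n)) - f (x (r n))) \<longlonglongrightarrow> f l - f l"
        by (intro tendsto_diff) simp_all
      then show False using no[OF 1(1)] by simp
    next
      case (2 r)
      have "(\<lambda>n. t (r n)) \<longlonglongrightarrow> 0" using LIMSEQ_subseq_LIMSEQ[OF t0 2(1)] by (simp add: comp_def)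
      from P_escape[OF less_imp_le[OF tx(1)] this order_refl tx(3) 2(2) f]
      obtain r' where r': "strict_mono (r' :: nat \<Rightarrow> nat)"
        "(\<lambda>n. ?F (t (r (r' n))) (x (r (r' n)))) \<longlonglongrightarrow> 0" .
      have "(\<lambda>n. f (x (r (r' n)))) \<longlonglongrightarrow> 0"
        by (intro tendsto_C0D_at_infinity f tx(3) filterlim_compose[OF 2(2) filterlim_subseq[OF r'(1)]])
      with r'(2) have "(\<lambda>n. ?F (t (r (r' n))) (x (r (r' n))) - f (x (r (r' n)))) \<longlonglongrightarrow> 0 - 0"
        by (rule tendsto_diff)
      then show False using no[of "r \<circ> r'"] 2(1) r'(1) by (simp add: strict_mono_o)
    qed
  qed
qed

lemma feller: "feller P"
  by (simp add: feller_def P_C0D P_uniform_limit)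

end

theorem proposition3p2:
  fixes Q P :: "real \<Rightarrow> real \<times> real \<Rightarrow> (real \<times> real) measure"
    and \<psi> :: "real \<Rightarrow> complex \<times> complex \<Rightarrow> complex \<times> complex"
    and \<gamma> :: "real \<Rightarrow> (real \<times> real) measure"
  assumes "regular_HA_semigroup Q \<psi>"
    and "SC_semigroup Q \<gamma>"
    and "weakly_continuous \<gamma>"
    and "\<And>t x. 0 \<le> t \<Longrightarrow> x \<in> stateD \<Longrightarrow> P t x = convD (Q t x) (\<gamma> t)"
  shows "affine_semigroup Q \<psi> P \<and> feller P"
proof -
  interpret affine_setting Q P \<psi> \<gamma>
    using assms by unfold_locales
  show ?thesis by (simp add: affine feller)
qed

end
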